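(* Let $\alpha>0$, $K_\Sigma>0$. Suppose that the characteristic function $\phi_Z$ of $Z$ satisfies $$|\phi_Z(t)|\le\frac{d_1}{1+|t|^\beta},\qquad|\phi_Z'(t)|\le\frac{d_1}{1+|t|^\beta}\qquad\text{for all }t\in\mathbb R$$ for some constants $d_1>0$ and $\beta>1/2$. Let $\inf_{\widetilde p_n}$ denote the infimum over all estimators $\widetilde p_n$ of $p$ based on the sample $X_1,\dots,X_n$. Then $$\inf_{\widetilde p_n}\ \sup_{f\in\Sigma(\alpha,K_\Sigma),\,p\in[0,1)}\mathbb E_{p,f}\big[(\widetilde p_n-p)^2\big]\gtrsim n^{-(2\alpha+1)/(2\alpha+2\beta)}.$$
   Context: Model: $X_1,\dots,X_n$ are i.i.d. copies of $X=Y+Z$, where $Y$ and $Z$ are independent, $Y=AV$ with $A$ and $V$ independent, $A$ Bernoulli with $P(A=1)=1-p$, $V$ has probability density $f$ on $\mathbb R$, and $Z$ has a known distribution with density $k$. $\mathbb E_{p,f}$ denotes expectation under the parameter $(p,f)$. $\phi_f(t)=\int_{-\infty}^\infty e^{itx}f(x)\,dx$. Class of densities: $\Sigma(\alpha,K_\Sigma)=\{f \text{ probability density}:\int_{-\infty}^\infty|\phi_f(t)|^2(1+|t|^{2\alpha})\,dt\le K_\Sigma\}$. $a_n\gtrsim b_n$ means $a_n\ge c\,b_n$ for all $n\geq 1$, with a constant $c>0$ not depending on $n$. *)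

theory Defs
  imports "HOL-Probability.Probability"
begin

definition prob_density :: "(real \<Rightarrow> real) \<Rightarrow> bool" where
  "prob_density f \<longleftrightarrow>
     f \<in> borel_measurable borel \<and> (\<forall>x. 0 \<le> f x) \<and> (\<integral>\<^sup>+x. ennreal (f x) \<partial>lborel) = 1"

definition fourier :: "(real \<Rightarrow> real) \<Rightarrow> real \<Rightarrow> complex" where
  "fourier f t = (CLBINT x. iexp (t * x) * complex_of_real (f x))"

definition sobolev_class :: "real \<Rightarrow> real \<Rightarrow> (real \<Rightarrow> real) set" where
  "sobolev_class \<alpha> K =
     {f. prob_density f \<and>
         (\<integral>\<^sup>+t. ennreal ((cmod (fourier f t))\<^sup>2 * (1 + \<bar>t\<bar> powr (2 * \<alpha>))) \<partial>lborel) \<le> ennreal K}"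

text \<open>The law of \<open>X = A V + Z\<close>, realised on the product space of
  \<open>(A, V, Z)\<close>; \<open>A\<close> is Bernoulli with success probability \<open>1 - p\<close>.\<close>

definition obs_law :: "(real \<Rightarrow> real) \<Rightarrow> real \<Rightarrow> (real \<Rightarrow> real) \<Rightarrow> real measure" where
  "obs_law k p f =
     distr (measure_pmf (bernoulli_pmf (1 - p)) \<Otimes>\<^sub>M (density lborel f \<Otimes>\<^sub>M density lborel k))
       borel (\<lambda>(a, v, z). of_bool a * v + z)"

text \<open>Sanity check: \<open>distr\<close> silently yields the zero measure for a map that is not measurable.\<close>

lemma prob_space_density_lborel:
  assumes "prob_density f"
  shows "prob_space (density lborel f)"
  using assms by (intro prob_spaceI) (auto simp: prob_density_def emeasure_density)

lemma prob_space_obs_law: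
  assumes k: "prob_density k" and f: "prob_density f"
  shows "prob_space (obs_law k p f)"
proof -
  interpret V: prob_space "density lborel f" by (rule prob_space_density_lborel[OF f])
  interpret Z: prob_space "density lborel k" by (rule prob_space_density_lborel[OF k])
  interpret VZ: pair_prob_space "density lborel f" "density lborel k" ..
  interpret AVZ: pair_prob_space "measure_pmf (bernoulli_pmf (1 - p))"
    "density lborel f \<Otimes>\<^sub>M density lborel k" ..
  have "(\<lambda>(a, v, z). of_bool a * v + z :: real) \<in>
      borel_measurable (count_space UNIV \<Otimes>\<^sub>M (borel \<Otimes>\<^sub>M borel))"
    by measurable
  moreover have "sets (measure_pmf (bernoulli_pmf (1 - p)) \<Otimes>\<^sub>M
      (density lborel f \<Otimes>\<^sub>M density lborel k)) =
      sets (count_space UNIV \<Otimes>\<^sub>M (borel \<Otimes>\<^sub>M borel))"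
    by (intro sets_pair_measure_cong) auto
  ultimately show ?thesis
    unfolding obs_law_def
    by (intro AVZ.P.prob_space_distr) (simp cong: measurable_cong_sets)
qed

text \<open>An estimator is a Borel function of the sample \<open>(X\<^sub>1, \<dots>, X\<^sub>n)\<close>, which is
  indexed by \<open>{..<n}\<close>.  Risks are extended non-negative reals, since the
  squared error need not be integrable.\<close>

definition estimators :: "nat \<Rightarrow> ((nat \<Rightarrow> real) \<Rightarrow> real) set" where
  "estimators n = borel_measurable (\<Pi>\<^sub>M i\<in>{..<n}. borel)"

definition sq_risk ::
    "(real \<Rightarrow> real) \<Rightarrow> nat \<Rightarrow> ((nat \<Rightarrow> real) \<Rightarrow> real) \<Rightarrow> real \<Rightarrow> (real \<Rightarrow> real) \<Rightarrow> ennreal" where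
  "sq_risk k n T p f =
     (\<integral>\<^sup>+x. ennreal ((T x - p)\<^sup>2) \<partial>(\<Pi>\<^sub>M i\<in>{..<n}. obs_law k p f))"

end

theory Submission imports Defs
begin

text \<open>
  Two hypotheses are compared: \<open>p = 0\<close> with a density \<open>f\<^sub>0\<close>, and \<open>p = \<delta>\<close> with a density \<open>f\<^sub>1\<close>, where
  \<open>\<delta>\<close> is of order \<open>m powr (- (\<alpha> + 1 / 2))\<close> and \<open>m = n powr (1 / (2 * \<alpha> + 2 * \<beta>))\<close>. Inside \<open>f\<^sub>0\<close> the
  point mass \<open>\<delta>\<close> at \<open>0\<close> is imitated by a signed combination of Gaussians of scale \<open>1 / m\<close>, such that
  the characteristic functions of the two observations differ by
  \<open>\<delta> * (1 - exp (- t\<^sup>2 / m\<^sup>2)) ^ r\<close> times the one of the noise: this is negligible for \<open>\<bar>t\<bar> < m\<close>, where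
  the noise has not yet damped the signal. Both densities contain the same heavy-tailed component, so
  the density of an observation under the first hypothesis is at least of order \<open>1 / (1 + x\<^sup>2)\<close>. The
  chi-square divergence is therefore bounded by the \<open>L\<^sup>2\<close> norms of the difference of the
  characteristic functions and of its derivative, through the Plancherel inequality; the powers of \<open>m\<close>
  combine to order \<open>1 / n\<close>. Finally \<open>\<delta> \<le> E\<^sub>1 \<bar>T - \<delta>\<bar> + E\<^sub>0 (L * \<bar>T\<bar>)\<close> with the likelihood ratio \<open>L\<close>, and
  Cauchy--Schwarz bounds both terms by the risks.
\<close>

section \<open>Fourier transforms of integrable functions\<close>

text \<open>The rate balances two costs. A perturbation of height \<delta> on frequencies up to
  \<open>m\<close> has Sobolev energy of order \<delta>^2 m^(2\<alpha>+1); keeping this bounded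
  fixes \<delta>. After the high-pass factor and the noise, an amplitude \<delta> m^(-\<beta>)
  remains on a band of width \<open>m\<close>, a divergence of order \<delta>^2 m^(1-2\<beta>) per
  observation; equating it with 1/n fixes \<open>m\<close>. The obstacle is the denominator of the
  divergence: the null density of an observation needs a lower bound at every point, and dividing by
  it costs a weight that grows as fast as that bound decays. Control of one derivative of the noise
  transform pays for the weight 1 + x^2, which dictates the tails of the hypotheses. Multiplying by
  x may then destroy integrability, so the derivative enters through difference quotients in
  frequency. The order \<open>r\<close> depends on \<beta>: the zero of the high-pass factor at
  frequency 0 has to compensate |t|^\<beta> up to the cutoff, with one factor in reserve for
  differentiation.\<close>

lemma integrable_iexp_mult:
  fixes f :: "real \<Rightarrow> real"
  assumes "integrable lborel f"
  shows "integrable lborel (\<lambda>x. iexp (t * x) * complex_of_real (f x))"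
proof -
  have [measurable]: "f \<in> borel_measurable borel"
    using assms by auto
  show ?thesis
    by (rule Bochner_Integration.integrable_bound[OF assms]) (auto simp: norm_mult)
qed

lemma fourier_measurable:
  assumes "integrable lborel f"
  shows "fourier f \<in> borel_measurable borel"
proof -
  have [measurable]: "f \<in> borel_measurable borel"
    using assms by auto
  show ?thesis
    unfolding fourier_def by measurable
qed

lemma norm_fourier_le:
  assumes "integrable lborel f"
  shows "cmod (fourier f t) \<le> (\<integral>x. \<bar>f x\<bar> \<partial>lborel)"
proof -
  have "cmod (fourier f t) \<le> (\<integral>x. cmod (iexp (t * x) * complex_of_real (f x)) \<partial>lborel)"
    unfolding fourier_def by (rule integral_norm_bound)
  then show ?thesis
    by (simp add: norm_mult)
qed

lemma fourier_lincomb: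
  assumes "integrable lborel f" "integrable lborel g"
  shows "fourier (\<lambda>x. a * f x + b * g x) t = a * fourier f t + b * fourier g t"
proof -
  have "fourier (\<lambda>x. a * f x + b * g x) t =
      (\<integral>x. a * (iexp (t * x) * f x) + b * (iexp (t * x) * g x) \<partial>lborel)"
    unfolding fourier_def by (intro Bochner_Integration.integral_cong) (auto simp: algebra_simps)
  also have "\<dots> = (\<integral>x. a * (iexp (t * x) * f x) \<partial>lborel) + (\<integral>x. b * (iexp (t * x) * g x) \<partial>lborel)"
    by (intro Bochner_Integration.integral_add integrable_mult_right integrable_iexp_mult assms)
  finally show ?thesis
    by (simp add: fourier_def)
qed

lemma fourier_sum:
  assumes "\<And>j. j \<in> J \<Longrightarrow> integrable lborel (f j)"
  shows "fourier (\<lambda>x. \<Sum>j\<in>J. c j * f j x) t = (\<Sum>j\<in>J. c j * fourier (f j) t)"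
proof -
  have "fourier (\<lambda>x. \<Sum>j\<in>J. c j * f j x) t = (\<integral>x. (\<Sum>j\<in>J. c j * (iexp (t * x) * f j x)) \<partial>lborel)"
    unfolding fourier_def
    by (intro Bochner_Integration.integral_cong) (auto simp: sum_distrib_left mult_ac)
  also have "\<dots> = (\<Sum>j\<in>J. (\<integral>x. c j * (iexp (t * x) * f j x) \<partial>lborel))"
    by (intro Bochner_Integration.integral_sum integrable_mult_right integrable_iexp_mult assms)
  finally show ?thesis
    by (simp add: fourier_def)
qed

section \<open>Gaussian transforms and a regularised Parseval identity\<close>

lemma char_density_eq_fourier:
  assumes "f \<in> borel_measurable borel" "\<And>x. 0 \<le> f x"
  shows "char (density lborel f) t = fourier f t"
  using assms unfolding char_def fourier_def
  by (subst integral_density) (auto simp: scaleR_conv_of_real mult.commute)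

lemma fourier_normal_density:
  assumes "0 < \<sigma>"
  shows "fourier (normal_density 0 \<sigma>) t = exp (- (\<sigma>\<^sup>2 * t\<^sup>2 / 2))"
proof -
  have "fourier (normal_density 0 \<sigma>) t =
      \<bar>\<sigma>\<bar> *\<^sub>R (\<integral>x. iexp (t * (0 + \<sigma> * x)) * normal_density 0 \<sigma> (0 + \<sigma> * x) \<partial>lborel)"
    unfolding fourier_def using assms by (intro lborel_integral_real_affine) auto
  also have "\<dots> = (\<integral>x. \<bar>\<sigma>\<bar> *\<^sub>R (iexp (t * (0 + \<sigma> * x)) * normal_density 0 \<sigma> (0 + \<sigma> * x)) \<partial>lborel)"
    by simp
  also have "\<dots> = (\<integral>x. iexp ((t * \<sigma>) * x) * std_normal_density x \<partial>lborel)"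
  proof (intro Bochner_Integration.integral_cong refl)
    fix x
    have "\<bar>\<sigma>\<bar> * normal_density 0 \<sigma> (\<sigma> * x) = std_normal_density x"
      using assms by (simp add: normal_density_def real_sqrt_mult power_mult_distrib)
    then have "complex_of_real \<bar>\<sigma>\<bar> * normal_density 0 \<sigma> (\<sigma> * x) = std_normal_density x"
      by (metis of_real_mult)
    then show "\<bar>\<sigma>\<bar> *\<^sub>R (iexp (t * (0 + \<sigma> * x)) * complex_of_real (normal_density 0 \<sigma> (0 + \<sigma> * x))) =
        iexp ((t * \<sigma>) * x) * complex_of_real (std_normal_density x)"
      by (simp add: scaleR_conv_of_real mult_ac)
  qed
  also have "\<dots> = char std_normal_distribution (t * \<sigma>)"
    by (subst char_density_eq_fourier) (auto simp: fourier_def)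
  finally show ?thesis
    by (simp add: char_std_normal_distribution power_mult_distrib mult_ac)
qed

text \<open>Fubini on \<open>lborel\<close> times \<open>G\<close>: since \<open>G\<close> is finite
  and \<open>c\<close> is bounded, \<open>\<bar>a x\<bar> * B\<close> dominates the integrand, even
  where \<open>fourier a\<close> does not decay.\<close>

lemma integral_fourier_mult_swap:
  fixes c :: "real \<Rightarrow> complex"
  assumes G: "finite_measure G" "sets G = sets borel" and a: "integrable lborel a"
    and c[measurable]: "c \<in> borel_measurable borel" and B: "\<And>t. cmod (c t) \<le> B"
  shows "(\<integral>t. fourier a t * c t \<partial>G) = (\<integral>x. a x * (\<integral>t. iexp (t * x) * c t \<partial>G) \<partial>lborel)"
proof -
  interpret G: finite_measure G by (fact G)
  interpret P: pair_sigma_finite lborel G ..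
  note [measurable_cong] = G(2)
  have [measurable]: "a \<in> borel_measurable borel"
    using a by auto
  have "integrable (lborel \<Otimes>\<^sub>M G) (\<lambda>(x, t). complex_of_real (a x) * (iexp (t * x) * c t))"
  proof (rule Bochner_Integration.integrable_bound)
    show "integrable (lborel \<Otimes>\<^sub>M G) (\<lambda>(x, t). \<bar>a x\<bar> * B)"
      by (rule P.Fubini_integrable) (use a in \<open>auto simp: abs_mult\<close>)
    show "AE p in lborel \<Otimes>\<^sub>M G. norm (case p of (x, t) \<Rightarrow> complex_of_real (a x) * (iexp (t * x) * c t))
        \<le> norm (case p of (x, t) \<Rightarrow> \<bar>a x\<bar> * B)"
      using B by (auto simp: norm_mult abs_mult split: prod.split intro!: mult_left_mono AE_I2 order_trans[OF B])
  qed measurable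
  from P.Fubini_integral[OF this] show ?thesis
    unfolding fourier_def by (simp add: mult_ac flip: integral_mult_left_zero integral_mult_right_zero)
qed

text \<open>Parseval with a Gaussian cutoff. Transforms of integrable functions are bounded but need
  not be integrable, so the frequency integral is taken against a normal law of standard deviation
  1/\<epsilon>; the characteristic function of that law is the Gaussian kernel of scale \<epsilon>
  on the right.\<close>

lemma integral_fourier_mult_cnj_fourier:
  assumes e: "0 < \<epsilon>" and a: "integrable lborel a" and b: "integrable lborel b"
  shows "(\<integral>t. fourier a t * cnj (fourier b t) \<partial>density lborel (normal_density 0 (1 / \<epsilon>))) =
    (\<integral>x. a x * (\<integral>y. b y * exp (- (x - y)\<^sup>2 / (2 * \<epsilon>\<^sup>2)) \<partial>lborel) \<partial>lborel)"
proof -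
  let ?G = "density lborel (normal_density 0 (1 / \<epsilon>))"
  interpret G: prob_space ?G
    by (rule prob_space_normal_density) (use e in auto)
  have inner: "(\<integral>t. iexp (t * x) * cnj (fourier b t) \<partial>?G) =
      (\<integral>y. b y * exp (- (x - y)\<^sup>2 / (2 * \<epsilon>\<^sup>2)) \<partial>lborel)" for x
  proof -
    have G_char: "(\<integral>t. iexp (t * y) * iexp (t * - x) \<partial>?G) = exp (- (x - y)\<^sup>2 / (2 * \<epsilon>\<^sup>2))" for y
    proof -
      have "(\<integral>t. iexp (t * y) * iexp (t * - x) \<partial>?G) = char ?G (y - x)"
        unfolding char_def
        by (intro Bochner_Integration.integral_cong) (auto simp: exp_add[symmetric] algebra_simps)
      also have "\<dots> = exp (- ((1 / \<epsilon>)\<^sup>2 * (y - x)\<^sup>2 / 2))"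
        using e by (subst char_density_eq_fourier) (auto simp: fourier_normal_density)
      finally show ?thesis
        by (simp add: power_divide power2_commute mult_ac)
    qed
    have "(\<integral>t. iexp (t * x) * cnj (fourier b t) \<partial>?G) = (\<integral>t. cnj (fourier b t * iexp (t * - x)) \<partial>?G)"
      by (intro Bochner_Integration.integral_cong) (auto simp: exp_cnj mult.commute)
    also have "\<dots> = cnj (\<integral>t. fourier b t * iexp (t * - x) \<partial>?G)"
      by (rule Bochner_Integration.integral_cnj)
    also have "(\<integral>t. fourier b t * iexp (t * - x) \<partial>?G) =
        (\<integral>y. b y * (\<integral>t. iexp (t * y) * iexp (t * - x) \<partial>?G) \<partial>lborel)"
      by (rule integral_fourier_mult_swap[where B = 1])
         (use b in \<open>auto intro: G.finite_measure_axioms\<close>)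
    finally show ?thesis
      unfolding G_char by (simp flip: of_real_mult)
  qed
  have [measurable]: "fourier b \<in> borel_measurable borel"
    by (rule fourier_measurable[OF b])
  have [measurable]: "cnj \<in> borel_measurable borel"
    by (intro borel_measurable_continuous_onI continuous_intros)
  have [measurable]: "(\<lambda>t. cnj (fourier b t)) \<in> borel_measurable borel"
    by measurable
  have "(\<integral>t. fourier a t * cnj (fourier b t) \<partial>?G) =
      (\<integral>x. a x * (\<integral>t. iexp (t * x) * cnj (fourier b t) \<partial>?G) \<partial>lborel)"
    by (rule integral_fourier_mult_swap[where B = "\<integral>x. \<bar>b x\<bar> \<partial>lborel"])
       (use a b in \<open>auto intro: G.finite_measure_axioms norm_fourier_le\<close>)
  then show ?thesis
    by (simp add: inner flip: of_real_mult)
qed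

section \<open>The Plancherel inequality\<close>

text \<open>Fatou's lemma, in the form that carries uniform bounds through truncations and
  difference quotients.\<close>

lemma nn_integral_le_of_LIMSEQ:
  fixes f :: "nat \<Rightarrow> 'a \<Rightarrow> ennreal"
  assumes f: "\<And>n. f n \<in> borel_measurable M" and lim: "\<And>x. (\<lambda>n. f n x) \<longlonglongrightarrow> F x"
    and le: "\<And>n. (\<integral>\<^sup>+x. f n x \<partial>M) \<le> C"
  shows "(\<integral>\<^sup>+x. F x \<partial>M) \<le> C"
proof -
  have "(\<integral>\<^sup>+x. F x \<partial>M) = (\<integral>\<^sup>+x. liminf (\<lambda>n. f n x) \<partial>M)"
    by (intro nn_integral_cong lim_imp_Liminf[symmetric] lim) simp
  also have "\<dots> \<le> liminf (\<lambda>n. \<integral>\<^sup>+x. f n x \<partial>M)"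
    by (rule nn_integral_liminf) (rule f)
  also have "\<dots> \<le> limsup (\<lambda>n. \<integral>\<^sup>+x. f n x \<partial>M)"
    by (rule Liminf_le_Limsup) simp
  also have "\<dots> \<le> C"
    by (rule Limsup_bounded) (simp add: le)
  finally show ?thesis .
qed

text \<open>For a non-integrable \<open>f\<close> the left side is 0 by the convention for the
  Bochner integral, so the bound holds for every \<open>f\<close>.\<close>

lemma norm_integral_le_nn_integral:
  fixes f :: "'a \<Rightarrow> 'b::{banach, second_countable_topology}"
  shows "ennreal (norm (\<integral>x. f x \<partial>M)) \<le> (\<integral>\<^sup>+x. ennreal (norm (f x)) \<partial>M)"
  by (cases "integrable M f") (auto simp: not_integrable_integral_eq intro: integral_norm_bound_ennreal)

lemma nn_integral_normal_density [simp]: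
  "0 < \<sigma> \<Longrightarrow> (\<integral>\<^sup>+x. ennreal (normal_density \<mu> \<sigma> x) \<partial>lborel) = 1"
  by (subst nn_integral_eq_integral) auto

lemma exp_eq_normal_density:
  assumes "0 < \<epsilon>"
  shows "exp (- (x - y)\<^sup>2 / (2 * \<epsilon>\<^sup>2)) = \<epsilon> * sqrt (2 * pi) * normal_density x \<epsilon> y"
  using assms by (simp add: normal_density_def real_sqrt_mult power2_commute[of x y])

lemma integrable_bounded_support:
  fixes u :: "real \<Rightarrow> real"
  assumes [measurable]: "u \<in> borel_measurable borel"
    and B: "\<And>x. \<bar>u x\<bar> \<le> B" and R: "\<And>x. R < \<bar>x\<bar> \<Longrightarrow> u x = 0"
  shows "integrable lborel u"
proof (rule Bochner_Integration.integrable_bound)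
  show "integrable lborel (\<lambda>x. B * indicator {-R..R} x :: real)"
    by (intro integrable_mult_right integrable_real_indicator)
       (cases "-R \<le> R"; simp)+
  show "AE x in lborel. norm (u x) \<le> norm (B * indicator {-R..R} x :: real)"
  proof (rule AE_I2)
    fix x
    show "norm (u x) \<le> norm (B * indicator {-R..R} x :: real)"
      using B[of x] R[of x] by (cases "\<bar>x\<bar> \<le> R") (auto simp: indicator_def)
  qed
qed simp

text \<open>A Schur test: the kernel has mass 1 in each variable, so splitting |u x| |u y| into half
  the sum of the squares gives constant 1, uniformly in \<epsilon>.\<close>

lemma nn_integral_gaussian_form_le:
  fixes u :: "real \<Rightarrow> real"
  assumes e: "0 < \<epsilon>" and [measurable]: "u \<in> borel_measurable borel"
  shows "(\<integral>\<^sup>+x. \<integral>\<^sup>+y. ennreal (\<bar>u x\<bar> * (\<bar>u y\<bar> * normal_density x \<epsilon> y)) \<partial>lborel \<partial>lborel)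
    \<le> (\<integral>\<^sup>+x. ennreal ((u x)\<^sup>2) \<partial>lborel)"
proof -
  define a where "a x y = ennreal ((u x)\<^sup>2 / 2) * ennreal (normal_density x \<epsilon> y)" for x y
  have [measurable]: "(\<lambda>(x, y). a x y) \<in> borel_measurable (borel \<Otimes>\<^sub>M borel)"
    unfolding a_def normal_density_def by measurable
  have sym: "normal_density x \<epsilon> y = normal_density y \<epsilon> x" for x y
    by (simp add: normal_density_def power2_commute)
  have half: "(\<integral>\<^sup>+x. \<integral>\<^sup>+y. a x y \<partial>lborel \<partial>lborel) = (\<integral>\<^sup>+x. ennreal ((u x)\<^sup>2 / 2) \<partial>lborel)"
    unfolding a_def using e by (simp add: nn_integral_cmult)
  have "(\<integral>\<^sup>+x. \<integral>\<^sup>+y. ennreal (\<bar>u x\<bar> * (\<bar>u y\<bar> * normal_density x \<epsilon> y)) \<partial>lborel \<partial>lborel)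
      \<le> (\<integral>\<^sup>+x. \<integral>\<^sup>+y. a x y + a y x \<partial>lborel \<partial>lborel)"
  proof (intro nn_integral_mono)
    fix x y
    have "\<bar>u x\<bar> * \<bar>u y\<bar> \<le> (u x)\<^sup>2 / 2 + (u y)\<^sup>2 / 2"
      using sum_squares_bound[of "\<bar>u x\<bar>" "\<bar>u y\<bar>"] by simp
    then have "(\<bar>u x\<bar> * \<bar>u y\<bar>) * normal_density x \<epsilon> y \<le> ((u x)\<^sup>2 / 2 + (u y)\<^sup>2 / 2) * normal_density x \<epsilon> y"
      by (rule mult_right_mono) simp
    also have "\<dots> = (u x)\<^sup>2 / 2 * normal_density x \<epsilon> y + (u y)\<^sup>2 / 2 * normal_density y \<epsilon> x"
      by (simp add: algebra_simps sym[of x y])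
    finally show "ennreal (\<bar>u x\<bar> * (\<bar>u y\<bar> * normal_density x \<epsilon> y)) \<le> a x y + a y x"
      by (simp add: a_def mult.assoc ennreal_leI flip: ennreal_mult ennreal_plus)
  qed
  also have "\<dots> = (\<integral>\<^sup>+x. (\<integral>\<^sup>+y. a x y \<partial>lborel) + (\<integral>\<^sup>+y. a y x \<partial>lborel) \<partial>lborel)"
    by (intro nn_integral_cong nn_integral_add) auto
  also have "\<dots> = (\<integral>\<^sup>+x. \<integral>\<^sup>+y. a x y \<partial>lborel \<partial>lborel) + (\<integral>\<^sup>+x. \<integral>\<^sup>+y. a y x \<partial>lborel \<partial>lborel)"
    by (intro nn_integral_add) auto
  also have "(\<integral>\<^sup>+x. \<integral>\<^sup>+y. a y x \<partial>lborel \<partial>lborel) = (\<integral>\<^sup>+x. \<integral>\<^sup>+y. a x y \<partial>lborel \<partial>lborel)"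
    by (intro lborel_pair.Fubini') auto
  also have "(\<integral>\<^sup>+x. \<integral>\<^sup>+y. a x y \<partial>lborel \<partial>lborel) + (\<integral>\<^sup>+x. \<integral>\<^sup>+y. a x y \<partial>lborel \<partial>lborel)
      = (\<integral>\<^sup>+x. ennreal ((u x)\<^sup>2) \<partial>lborel)"
    unfolding half by (subst nn_integral_add[symmetric]) (auto simp flip: ennreal_plus)
  finally show ?thesis .
qed

text \<open>Cauchy-Schwarz in frequency against the Gaussian weight. For \<open>u\<close>, the
  regularised Parseval identity leads back to a quadratic form, at most
  \<open>\<epsilon> * sqrt (2 * pi)\<close> times the integral of u^2; for \<open>d\<close> the
  weight contributes \<open>\<epsilon> / sqrt (2 * pi)\<close>. The resulting \<epsilon>^2 cancels
  the one in the square of the normalisation \<open>?c\<close>, so the bound is uniform in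
  \<epsilon> and carries the Plancherel constant 1 / (2 pi).\<close>

lemma gaussian_pairing_le:
  assumes e: "0 < \<epsilon>" and d: "integrable lborel d" and M: "0 \<le> M"
    and dM: "(\<integral>\<^sup>+t. ennreal ((cmod (fourier d t))\<^sup>2) \<partial>lborel) \<le> ennreal M"
    and u: "integrable lborel u" and u2: "integrable lborel (\<lambda>x. (u x)\<^sup>2)"
  shows "(\<integral>x. d x * (\<integral>y. u y * normal_density x \<epsilon> y \<partial>lborel) \<partial>lborel)\<^sup>2
    \<le> M / (2 * pi) * (\<integral>x. (u x)\<^sup>2 \<partial>lborel)"
proof -
  let ?G = "density lborel (normal_density 0 (1 / \<epsilon>))"
  let ?c = "\<epsilon> * sqrt (2 * pi)"
  define J where "J a b = (\<integral>x. a x * (\<integral>y. b y * normal_density x \<epsilon> y \<partial>lborel) \<partial>lborel)"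
    for a b :: "real \<Rightarrow> real"
  have c: "0 < ?c" using e by simp
  have [measurable]: "d \<in> borel_measurable borel" "u \<in> borel_measurable borel"
    using d u by auto
  note [measurable] = fourier_measurable[OF d] fourier_measurable[OF u]
  interpret G: prob_space ?G
    by (rule prob_space_normal_density) (use e in auto)
  have J: "(\<integral>t. fourier a t * cnj (fourier b t) \<partial>?G) = ?c * J a b"
    if "integrable lborel a" "integrable lborel b" for a b
    unfolding J_def integral_fourier_mult_cnj_fourier[OF e that] exp_eq_normal_density[OF e]
    by (simp add: mult.left_commute mult.assoc flip: integral_mult_right_zero of_real_mult)
  have intu: "integrable ?G (\<lambda>t. (cmod (fourier u t))\<^sup>2)"
    by (rule G.integrable_const_bound[where B = "(\<integral>x. \<bar>u x\<bar> \<partial>lborel)\<^sup>2"])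
       (auto intro!: power_mono norm_fourier_le u)
  have "(\<integral>\<^sup>+t. ennreal ((cmod (fourier u t))\<^sup>2) \<partial>?G) = ennreal (\<integral>t. (cmod (fourier u t))\<^sup>2 \<partial>?G)"
    by (rule nn_integral_eq_integral[OF intu]) auto
  also have "(\<integral>t. (cmod (fourier u t))\<^sup>2 \<partial>?G) = ?c * J u u"
  proof -
    have "complex_of_real (\<integral>t. (cmod (fourier u t))\<^sup>2 \<partial>?G) = (\<integral>t. fourier u t * cnj (fourier u t) \<partial>?G)"
      by (subst integral_complex_of_real[symmetric])
         (simp only: complex_norm_square)
    then show ?thesis
      unfolding J[OF u u] of_real_eq_iff by simp
  qed
  also have "ennreal (?c * J u u) = ennreal ?c * ennreal (J u u)"
    using c by (intro ennreal_mult') auto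
  also have "\<dots> \<le> ennreal ?c * ennreal (\<integral>x. (u x)\<^sup>2 \<partial>lborel)"
  proof (rule mult_left_mono)
    have "ennreal (J u u) \<le> ennreal \<bar>J u u\<bar>"
      by (intro ennreal_leI) simp
    also have "\<dots> \<le> (\<integral>\<^sup>+x. ennreal (norm (u x * (\<integral>y. u y * normal_density x \<epsilon> y \<partial>lborel))) \<partial>lborel)"
      unfolding J_def real_norm_def[symmetric] by (rule norm_integral_le_nn_integral)
    also have "\<dots> \<le> (\<integral>\<^sup>+x. ennreal \<bar>u x\<bar> * (\<integral>\<^sup>+y. ennreal \<bar>u y * normal_density x \<epsilon> y\<bar> \<partial>lborel) \<partial>lborel)"
    proof (intro nn_integral_mono)
      fix x
      have "ennreal (norm (\<integral>y. u y * normal_density x \<epsilon> y \<partial>lborel))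
          \<le> (\<integral>\<^sup>+y. ennreal (norm (u y * normal_density x \<epsilon> y)) \<partial>lborel)"
        by (rule norm_integral_le_nn_integral)
      then show "ennreal (norm (u x * (\<integral>y. u y * normal_density x \<epsilon> y \<partial>lborel)))
          \<le> ennreal \<bar>u x\<bar> * (\<integral>\<^sup>+y. ennreal \<bar>u y * normal_density x \<epsilon> y\<bar> \<partial>lborel)"
        by (simp add: abs_mult ennreal_mult' mult_left_mono)
    qed
    also have "\<dots> = (\<integral>\<^sup>+x. \<integral>\<^sup>+y. ennreal (\<bar>u x\<bar> * (\<bar>u y\<bar> * normal_density x \<epsilon> y)) \<partial>lborel \<partial>lborel)"
      by (intro nn_integral_cong, subst nn_integral_cmult[symmetric]) (auto simp: abs_mult ennreal_mult')
    also have "\<dots> \<le> (\<integral>\<^sup>+x. ennreal ((u x)\<^sup>2) \<partial>lborel)"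
      by (rule nn_integral_gaussian_form_le[OF e]) simp
    also have "\<dots> = ennreal (\<integral>x. (u x)\<^sup>2 \<partial>lborel)"
      by (rule nn_integral_eq_integral[OF u2]) auto
    finally show "ennreal (J u u) \<le> ennreal (\<integral>x. (u x)\<^sup>2 \<partial>lborel)" .
  qed simp
  finally have bu: "(\<integral>\<^sup>+t. ennreal ((cmod (fourier u t))\<^sup>2) \<partial>?G) \<le> ennreal (?c * (\<integral>x. (u x)\<^sup>2 \<partial>lborel))"
    using c by (simp add: ennreal_mult')
  have "(\<integral>\<^sup>+t. ennreal ((cmod (fourier d t))\<^sup>2) \<partial>?G)
      = (\<integral>\<^sup>+t. ennreal (normal_density 0 (1 / \<epsilon>) t) * ennreal ((cmod (fourier d t))\<^sup>2) \<partial>lborel)"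
    by (subst nn_integral_density) auto
  \<comment> \<open>\<open>\<epsilon> / sqrt (2 * pi)\<close> is the maximum of the weight, attained
    at frequency 0.\<close>
  also have "\<dots> \<le> (\<integral>\<^sup>+t. ennreal (\<epsilon> / sqrt (2 * pi)) * ennreal ((cmod (fourier d t))\<^sup>2) \<partial>lborel)"
  proof (intro nn_integral_mono mult_right_mono ennreal_leI)
    fix t
    show "normal_density 0 (1 / \<epsilon>) t \<le> \<epsilon> / sqrt (2 * pi)"
      using e by (simp add: normal_density_def real_sqrt_mult real_sqrt_divide power_divide field_simps)
  qed simp
  also have "\<dots> \<le> ennreal (\<epsilon> / sqrt (2 * pi)) * ennreal M"
    by (subst nn_integral_cmult) (auto intro: mult_left_mono dM)
  finally have bd: "(\<integral>\<^sup>+t. ennreal ((cmod (fourier d t))\<^sup>2) \<partial>?G) \<le> ennreal (\<epsilon> / sqrt (2 * pi) * M)"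
    using M e by (simp add: ennreal_mult' del: times_divide_eq_left)
  have "ennreal (?c * \<bar>J d u\<bar>) = ennreal (norm (\<integral>t. fourier d t * cnj (fourier u t) \<partial>?G))"
    using e unfolding J[OF d u] by (simp add: abs_mult norm_mult)
  also have "\<dots> \<le> (\<integral>\<^sup>+t. ennreal (norm (fourier d t * cnj (fourier u t))) \<partial>?G)"
    by (rule norm_integral_le_nn_integral)
  also have "\<dots> = (\<integral>\<^sup>+t. ennreal (cmod (fourier d t)) * ennreal (cmod (fourier u t)) \<partial>?G)"
    by (simp add: norm_mult ennreal_mult)
  finally have "(ennreal (?c * \<bar>J d u\<bar>))\<^sup>2 \<le> (\<integral>\<^sup>+t. ennreal (cmod (fourier d t)) * ennreal (cmod (fourier u t)) \<partial>?G)\<^sup>2"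
    by (rule power_mono) simp
  also have "\<dots> \<le> (\<integral>\<^sup>+t. (ennreal (cmod (fourier d t)))\<^sup>2 \<partial>?G) * (\<integral>\<^sup>+t. (ennreal (cmod (fourier u t)))\<^sup>2 \<partial>?G)"
    by (rule Cauchy_Schwarz_nn_integral) auto
  also have "\<dots> \<le> ennreal (\<epsilon> / sqrt (2 * pi) * M) * ennreal (?c * (\<integral>x. (u x)\<^sup>2 \<partial>lborel))"
    using bd bu by (intro mult_mono) (auto simp: ennreal_power)
  also have "\<dots> = ennreal (\<epsilon>\<^sup>2 * (M * (\<integral>x. (u x)\<^sup>2 \<partial>lborel)))"
    using e M by (subst ennreal_mult[symmetric]) (auto simp: power2_eq_square)
  finally have "(?c * \<bar>J d u\<bar>)\<^sup>2 \<le> \<epsilon>\<^sup>2 * (M * (\<integral>x. (u x)\<^sup>2 \<partial>lborel))"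
    using c M by (subst (asm) ennreal_power) (auto simp: ennreal_le_iff2)
  then have "(J d u)\<^sup>2 * (2 * pi) \<le> M * (\<integral>x. (u x)\<^sup>2 \<partial>lborel)"
    using e by (simp add: power_mult_distrib mult_ac)
  then show ?thesis
    by (simp add: J_def field_simps)
qed


text \<open>The Gaussian scale tends to 0: the averages of a continuous bounded \<open>u\<close>
  converge pointwise to \<open>u\<close>, and \<open>\<bar>d x\<bar> * B\<close> dominates.\<close>

lemma pairing_le_of_continuous:
  assumes d: "integrable lborel d" and M: "0 \<le> M"
    and dM: "(\<integral>\<^sup>+t. ennreal ((cmod (fourier d t))\<^sup>2) \<partial>lborel) \<le> ennreal M"
    and cont: "continuous_on UNIV u" and B: "\<And>x. \<bar>u x\<bar> \<le> B" and R: "\<And>x. R < \<bar>x\<bar> \<Longrightarrow> u x = 0"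
  shows "(\<integral>x. d x * u x \<partial>lborel)\<^sup>2 \<le> M / (2 * pi) * (\<integral>x. (u x)\<^sup>2 \<partial>lborel)"
proof -
  define e where "e n = 1 / real (Suc n)" for n
  have e: "0 < e n" "e \<longlonglongrightarrow> 0" for n
    unfolding e_def using LIMSEQ_Suc[OF lim_1_over_n] by (auto simp del: of_nat_Suc)
  have [measurable]: "u \<in> borel_measurable borel" "d \<in> borel_measurable borel"
    using cont d by (auto intro: borel_measurable_continuous_onI)
  have "0 \<le> B"
    using B[of 0] by simp
  have u: "integrable lborel u"
    by (rule integrable_bounded_support[OF _ B R]) auto
  have u2: "integrable lborel (\<lambda>x. (u x)\<^sup>2)"
    by (rule integrable_bounded_support[where B = "B\<^sup>2" and R = R])
       (use B R \<open>0 \<le> B\<close> in \<open>auto simp: abs_le_square_iff[symmetric]\<close>)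
  define v where "v n x = (\<integral>y. u y * normal_density x (e n) y \<partial>lborel)" for n x
  \<comment> \<open>The substitution y = x + e n * z moves the shrinking scale from the kernel into
    \<open>u\<close>, so one fixed density dominates for all \<open>n\<close>.\<close>
  have v: "v n x = (\<integral>z. u (x + e n * z) * std_normal_density z \<partial>lborel)" for n x
  proof -
    have "v n x = \<bar>e n\<bar> *\<^sub>R (\<integral>z. u (x + e n * z) * normal_density x (e n) (x + e n * z) \<partial>lborel)"
      unfolding v_def using e(1)[of n] by (intro lborel_integral_real_affine) auto
    also have "\<dots> = (\<integral>z. \<bar>e n\<bar> *\<^sub>R (u (x + e n * z) * normal_density x (e n) (x + e n * z)) \<partial>lborel)"
      by simp
    also have "\<dots> = (\<integral>z. u (x + e n * z) * std_normal_density z \<partial>lborel)"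
      using e(1)[of n]
      by (intro Bochner_Integration.integral_cong)
         (auto simp: normal_density_def real_sqrt_mult power_mult_distrib)
    finally show ?thesis .
  qed
  have v_lim: "(\<lambda>n. v n x) \<longlonglongrightarrow> u x" for x
  proof -
    have "(\<lambda>n. v n x) \<longlonglongrightarrow> (\<integral>z. u x * std_normal_density z \<partial>lborel)"
      unfolding v
    proof (rule integral_dominated_convergence[where w = "\<lambda>z. B * std_normal_density z"])
      show "AE z in lborel. (\<lambda>n. u (x + e n * z) * std_normal_density z) \<longlonglongrightarrow> u x * std_normal_density z"
      proof (rule AE_I2)
        fix z
        have "(\<lambda>n. x + e n * z) \<longlonglongrightarrow> x + 0 * z"
          by (intro tendsto_intros e)
        then have "(\<lambda>n. u (x + e n * z)) \<longlonglongrightarrow> u x"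
          using cont by (intro isCont_tendsto_compose[of x u]) (auto simp: continuous_on_eq_continuous_at)
        then show "(\<lambda>n. u (x + e n * z) * std_normal_density z) \<longlonglongrightarrow> u x * std_normal_density z"
          by (intro tendsto_intros)
      qed
    qed (use B in \<open>auto simp: abs_mult intro!: mult_right_mono\<close>)
    then show ?thesis by simp
  qed
  have v_bound: "\<bar>v n x\<bar> \<le> B" for n x
  proof -
    have "\<bar>v n x\<bar> \<le> (\<integral>z. norm (u (x + e n * z) * std_normal_density z) \<partial>lborel)"
      unfolding v real_norm_def[symmetric] by (rule integral_norm_bound)
    also have "\<dots> \<le> (\<integral>z. B * std_normal_density z \<partial>lborel)"
      using \<open>0 \<le> B\<close> B by (intro integral_mono') (auto simp: abs_mult intro!: mult_right_mono)
    finally show ?thesis by simp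
  qed
  have [measurable]: "v n \<in> borel_measurable borel" for n
    unfolding v by measurable
  have "(\<lambda>n. \<integral>x. d x * v n x \<partial>lborel) \<longlonglongrightarrow> (\<integral>x. d x * u x \<partial>lborel)"
    by (rule integral_dominated_convergence[where w = "\<lambda>x. \<bar>d x\<bar> * B"])
       (use d v_bound v_lim in \<open>auto simp: abs_mult intro!: mult_left_mono tendsto_intros\<close>)
  then have "(\<lambda>n. (\<integral>x. d x * v n x \<partial>lborel)\<^sup>2) \<longlonglongrightarrow> (\<integral>x. d x * u x \<partial>lborel)\<^sup>2"
    by (intro tendsto_intros)
  then show ?thesis
  proof (rule LIMSEQ_le_const2, intro exI allI impI)
    fix n
    show "(\<integral>x. d x * v n x \<partial>lborel)\<^sup>2 \<le> M / (2 * pi) * (\<integral>x. (u x)\<^sup>2 \<partial>lborel)"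
      unfolding v_def by (rule gaussian_pairing_le[OF e(1) d M dM u u2])
  qed
qed

text \<open>Measurability gives continuous functions converging to \<open>u\<close> off a null set.
  Clipping them to [-B, B] and multiplying by \<open>cut\<close> does not change the limit, since
  \<open>u\<close> has this bound and this support already. The extra 1 in the support is the room
  in which \<open>cut\<close> falls from 1 to 0.\<close>

lemma AE_limit_of_continuous:
  fixes u :: "real \<Rightarrow> real"
  assumes u: "u \<in> borel_measurable borel"
    and B: "\<And>x. \<bar>u x\<bar> \<le> B" and R: "\<And>x. R < \<bar>x\<bar> \<Longrightarrow> u x = 0"
  obtains h :: "nat \<Rightarrow> real \<Rightarrow> real" where "\<And>n. continuous_on UNIV (h n)" "\<And>n x. \<bar>h n x\<bar> \<le> B"
    "\<And>n x. R + 1 < \<bar>x\<bar> \<Longrightarrow> h n x = 0" "AE x in lborel. (\<lambda>n. h n x) \<longlonglongrightarrow> u x"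
proof -
  have "0 \<le> B"
    using B[of 0] by simp
  have "u measurable_on UNIV"
    using u by (intro lebesgue_measurable_imp_measurable_on) (auto intro: measurable_completion)
  then obtain N g where N: "negligible N" and g: "\<And>n. continuous_on UNIV (g n)"
    and lim: "\<And>x. x \<notin> N \<Longrightarrow> (\<lambda>n. g n x) \<longlonglongrightarrow> u x"
    unfolding measurable_on_def by auto
  define cut where "cut x = max 0 (min 1 (R + 1 - \<bar>x\<bar>))" for x
  define h where "h n x = max (- B) (min B (g n x)) * cut x" for n x
  have cut: "\<bar>cut x\<bar> \<le> 1" "R + 1 < \<bar>x\<bar> \<Longrightarrow> cut x = 0" "\<bar>x\<bar> \<le> R \<Longrightarrow> cut x = 1" for x
    unfolding cut_def by auto
  show ?thesis
  proof (rule that)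
    show "continuous_on UNIV (h n)" for n
      unfolding h_def cut_def by (intro continuous_intros g)
    show "\<bar>h n x\<bar> \<le> B" for n x
    proof -
      have "\<bar>max (- B) (min B (g n x))\<bar> \<le> B"
        using \<open>0 \<le> B\<close> by auto
      then have "\<bar>max (- B) (min B (g n x))\<bar> * \<bar>cut x\<bar> \<le> B * 1"
        using cut(1)[of x] \<open>0 \<le> B\<close> by (intro mult_mono) auto
      then show ?thesis by (simp add: h_def abs_mult)
    qed
    show "h n x = 0" if "R + 1 < \<bar>x\<bar>" for n x
      using cut(2)[OF that] by (simp add: h_def)
    have "AE x in lebesgue. x \<notin> N"
      using N by (simp add: AE_not_in negligible_iff_null_sets)
    then have "AE x in lborel. x \<notin> N"
      by (simp add: AE_completion_iff)
    then show "AE x in lborel. (\<lambda>n. h n x) \<longlonglongrightarrow> u x"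
    proof eventually_elim
      case (elim x)
      have "(\<lambda>n. h n x) \<longlonglongrightarrow> max (- B) (min B (u x)) * cut x"
        unfolding h_def by (intro tendsto_intros lim elim)
      also have "max (- B) (min B (u x)) * cut x = u x"
        using B[of x] R[of x] cut(3)[of x] by (cases "\<bar>x\<bar> \<le> R") (auto simp: abs_le_iff)
      finally show ?case .
    qed
  qed
qed

text \<open>Duality with \<open>d\<close> itself as test function. Square integrability of
  \<open>d\<close> is part of the claim, so \<open>d\<close> is truncated in value and in space; for
  the truncation the pairing equals the integral I of its square, and I^2 \<le> M / (2 pi) * I
  yields I \<le> M / (2 pi). Fatou removes the truncation.\<close>

theorem nn_integral_square_le_fourier:
  assumes d: "integrable lborel d" and M: "0 \<le> M"
    and dM: "(\<integral>\<^sup>+t. ennreal ((cmod (fourier d t))\<^sup>2) \<partial>lborel) \<le> ennreal M"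
  shows "(\<integral>\<^sup>+x. ennreal ((d x)\<^sup>2) \<partial>lborel) \<le> ennreal (M / (2 * pi))"
proof -
  have [measurable]: "d \<in> borel_measurable borel"
    using d by auto
  define u where "u N x = (if \<bar>d x\<bar> \<le> real N \<and> \<bar>x\<bar> \<le> real N then d x else 0)" for N x
  have [measurable]: "u N \<in> borel_measurable borel" for N
    unfolding u_def by measurable
  have uB: "\<bar>u N x\<bar> \<le> real N" and uR: "real N < \<bar>x\<bar> \<Longrightarrow> u N x = 0" for N x
    by (auto simp: u_def)
  have le: "(\<integral>\<^sup>+x. ennreal ((u N x)\<^sup>2) \<partial>lborel) \<le> ennreal (M / (2 * pi))" for N
  proof -
    obtain h :: "nat \<Rightarrow> real \<Rightarrow> real" where h: "\<And>n. continuous_on UNIV (h n)" "\<And>n x. \<bar>h n x\<bar> \<le> real N"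
      "\<And>n x. real N + 1 < \<bar>x\<bar> \<Longrightarrow> h n x = 0" "AE x in lborel. (\<lambda>n. h n x) \<longlonglongrightarrow> u N x"
      using AE_limit_of_continuous[of "u N" "real N" "real N"] uB uR by auto
    have [measurable]: "h n \<in> borel_measurable borel" for n
      using h(1) by (rule borel_measurable_continuous_onI)
    have sq: "integrable lborel (\<lambda>x. (real N)\<^sup>2 * indicator {- (real N + 1)..real N + 1} x)"
      by (intro integrable_mult_right integrable_real_indicator) auto
    \<comment> \<open>The truncation is discontinuous; its continuous approximations
      \<open>h\<close> inherit the pairing bound, which then passes to the limit.\<close>
    have 1: "(\<lambda>n. \<integral>x. d x * h n x \<partial>lborel) \<longlonglongrightarrow> (\<integral>x. d x * u N x \<partial>lborel)"
    proof (rule integral_dominated_convergence[where w = "\<lambda>x. \<bar>d x\<bar> * real N"])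
      show "AE x in lborel. (\<lambda>n. d x * h n x) \<longlonglongrightarrow> d x * u N x"
        using h(4) by eventually_elim (intro tendsto_intros)
    qed (use d h in \<open>auto simp: abs_mult intro!: mult_left_mono\<close>)
    have 2: "(\<lambda>n. \<integral>x. (h n x)\<^sup>2 \<partial>lborel) \<longlonglongrightarrow> (\<integral>x. (u N x)\<^sup>2 \<partial>lborel)"
    proof (rule integral_dominated_convergence[OF _ _ sq])
      show "AE x in lborel. (\<lambda>n. (h n x)\<^sup>2) \<longlonglongrightarrow> (u N x)\<^sup>2"
        using h(4) by eventually_elim (intro tendsto_intros)
      have "(h n x)\<^sup>2 \<le> (real N)\<^sup>2" for n x
        using h(2)[of n x] by (simp add: abs_le_square_iff[symmetric])
      then show "AE x in lborel. norm ((h n x)\<^sup>2) \<le> (real N)\<^sup>2 * indicator {- (real N + 1)..real N + 1} x" for n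
        using h(3)[of _ n] by (intro AE_I2) (force simp: indicator_def)
    qed auto
    have "(\<integral>x. d x * u N x \<partial>lborel)\<^sup>2 \<le> M / (2 * pi) * (\<integral>x. (u N x)\<^sup>2 \<partial>lborel)"
    proof (rule LIMSEQ_le)
      show "(\<lambda>n. (\<integral>x. d x * h n x \<partial>lborel)\<^sup>2) \<longlonglongrightarrow> (\<integral>x. d x * u N x \<partial>lborel)\<^sup>2"
        by (intro tendsto_intros 1)
      show "(\<lambda>n. M / (2 * pi) * (\<integral>x. (h n x)\<^sup>2 \<partial>lborel)) \<longlonglongrightarrow> M / (2 * pi) * (\<integral>x. (u N x)\<^sup>2 \<partial>lborel)"
        by (intro tendsto_intros 2)
      show "\<exists>k. \<forall>n\<ge>k. (\<integral>x. d x * h n x \<partial>lborel)\<^sup>2 \<le> M / (2 * pi) * (\<integral>x. (h n x)\<^sup>2 \<partial>lborel)"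
        using pairing_le_of_continuous[OF d M dM h(1) h(2) h(3)] by blast
    qed
    also have "(\<integral>x. d x * u N x \<partial>lborel) = (\<integral>x. (u N x)\<^sup>2 \<partial>lborel)"
      by (intro Bochner_Integration.integral_cong) (auto simp: u_def power2_eq_square)
    finally have "(\<integral>x. (u N x)\<^sup>2 \<partial>lborel) \<le> M / (2 * pi)"
    proof -
      assume *: "(\<integral>x. (u N x)\<^sup>2 \<partial>lborel)\<^sup>2 \<le> M / (2 * pi) * (\<integral>x. (u N x)\<^sup>2 \<partial>lborel)"
      have "0 \<le> (\<integral>x. (u N x)\<^sup>2 \<partial>lborel)"
        by (rule integral_nonneg_AE) simp
      moreover have "0 \<le> M / (2 * pi)"
        using M by simp
      ultimately show ?thesis
        using * by (cases "(\<integral>x. (u N x)\<^sup>2 \<partial>lborel) = 0") (auto simp only: power2_eq_square mult_le_cancel_right)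
    qed
    moreover have "integrable lborel (\<lambda>x. (u N x)\<^sup>2)"
      by (rule integrable_bounded_support[where B = "(real N)\<^sup>2" and R = "real N"])
         (use uB[of N] uR[of N] in \<open>auto simp: abs_le_square_iff[symmetric]\<close>)
    ultimately show ?thesis
      by (subst nn_integral_eq_integral) (auto intro: ennreal_leI)
  qed
  show ?thesis
  proof (rule nn_integral_le_of_LIMSEQ[OF _ _ le])
    show "(\<lambda>N. ennreal ((u N x)\<^sup>2)) \<longlonglongrightarrow> ennreal ((d x)\<^sup>2)" for x
    proof (rule tendsto_eventually)
      show "eventually (\<lambda>N. ennreal ((u N x)\<^sup>2) = ennreal ((d x)\<^sup>2)) sequentially"
        using eventually_ge_at_top[of "nat \<lceil>max \<bar>d x\<bar> \<bar>x\<bar>\<rceil>"]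
      proof eventually_elim
        case (elim N)
        then have "max \<bar>d x\<bar> \<bar>x\<bar> \<le> real N"
          by linarith
        then show ?case
          by (simp add: u_def)
      qed
    qed
  qed auto
qed

section \<open>Plancherel with weight 1 + x^2: sin(h x) / h as a bounded substitute for x\<close>

lemma fourier_mult_sin:
  assumes d: "integrable lborel d" and h: "0 < h"
  shows "fourier (\<lambda>x. d x * (sin (h * x) / h)) t = (fourier d (t + h) - fourier d (t - h)) / (2 * \<i> * h)"
proof -
  have "fourier d (t + h) - fourier d (t - h) =
      (\<integral>x. iexp ((t + h) * x) * d x - iexp ((t - h) * x) * d x \<partial>lborel)"
    unfolding fourier_def
    by (intro Bochner_Integration.integral_diff[symmetric] integrable_iexp_mult d)
  also have "\<dots> = (\<integral>x. (2 * \<i> * h) * (iexp (t * x) * (d x * (sin (h * x) / h))) \<partial>lborel)"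
  proof (intro Bochner_Integration.integral_cong refl)
    fix x
    have *: "iexp (h * x) - iexp (- (h * x)) = 2 * \<i> * sin (h * x)"
      unfolding sin_of_real[symmetric] sin_exp_eq by (simp add: field_simps)
    have "iexp ((t + h) * x) * d x - iexp ((t - h) * x) * d x =
        iexp (t * x) * d x * (iexp (h * x) - iexp (- (h * x)))"
      by (simp add: algebra_simps flip: exp_add)
    then show "iexp ((t + h) * x) * complex_of_real (d x) - iexp ((t - h) * x) * complex_of_real (d x) =
        (2 * \<i> * h) * (iexp (t * x) * complex_of_real (d x * (sin (h * x) / h)))"
      unfolding * using h by (simp add: field_simps)
  qed
  also have "\<dots> = (2 * \<i> * h) * fourier (\<lambda>x. d x * (sin (h * x) / h)) t"
    by (simp add: fourier_def)
  finally show ?thesis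
    using h by simp
qed

text \<open>Since x d(x) may fail to be integrable, x is replaced by the bounded multiplier sin(h x)
  / h, which acts on the transform as a symmetric difference quotient. Plancherel applies for each
  \<open>h\<close>, and Fatou lets \<open>h\<close> tend to 0. M / pi is the sum of two copies of M
  / (2 pi), one for the weight 1 and one for x^2.\<close>

theorem nn_integral_weighted_square_le_fourier:
  assumes d: "integrable lborel d" and M: "0 \<le> M"
    and dM: "(\<integral>\<^sup>+t. ennreal ((cmod (fourier d t))\<^sup>2) \<partial>lborel) \<le> ennreal M"
    and dM': "\<And>h. 0 < h \<Longrightarrow> h \<le> 1 \<Longrightarrow>
      (\<integral>\<^sup>+t. ennreal ((cmod (fourier d (t + h) - fourier d (t - h)) / (2 * h))\<^sup>2) \<partial>lborel) \<le> ennreal M"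
  shows "(\<integral>\<^sup>+x. ennreal ((1 + x\<^sup>2) * (d x)\<^sup>2) \<partial>lborel) \<le> ennreal (M / pi)"
proof -
  have [measurable]: "d \<in> borel_measurable borel"
    using d by auto
  define e where "e n = 1 / real (Suc n)" for n
  have e: "0 < e n" "e n \<le> 1" "e \<longlonglongrightarrow> 0" for n
    unfolding e_def using LIMSEQ_Suc[OF lim_1_over_n] by (auto simp del: of_nat_Suc)
  have bound: "(\<integral>\<^sup>+x. ennreal ((d x * (sin (e n * x) / e n))\<^sup>2) \<partial>lborel) \<le> ennreal (M / (2 * pi))" for n
  proof (rule nn_integral_square_le_fourier[OF _ M])
    show "integrable lborel (\<lambda>x. d x * (sin (e n * x) / e n))"
    proof (rule Bochner_Integration.integrable_bound)
      show "integrable lborel (\<lambda>x. d x * (1 / e n))"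
        using d by simp
      show "AE x in lborel. norm (d x * (sin (e n * x) / e n)) \<le> norm (d x * (1 / e n))"
        using e(1)[of n] by (intro AE_I2) (auto simp: abs_mult intro!: mult_left_mono divide_right_mono mult_left_le)
    qed simp
    have "cmod (fourier (\<lambda>x. d x * (sin (e n * x) / e n)) t) =
        cmod (fourier d (t + e n) - fourier d (t - e n)) / (2 * e n)" for t
      unfolding fourier_mult_sin[OF d e(1)] using e(1)[of n] by (simp add: norm_divide norm_mult)
    then show "(\<integral>\<^sup>+t. ennreal ((cmod (fourier (\<lambda>x. d x * (sin (e n * x) / e n)) t))\<^sup>2) \<partial>lborel) \<le> ennreal M"
      using dM'[OF e(1,2)[of n]] by simp
  qed
  have "(\<integral>\<^sup>+x. ennreal ((d x * x)\<^sup>2) \<partial>lborel) \<le> ennreal (M / (2 * pi))"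
  proof (rule nn_integral_le_of_LIMSEQ[OF _ _ bound])
    fix x
    have "(\<lambda>n. sin (e n * x) / e n) \<longlonglongrightarrow> x"
    proof -
      have "((\<lambda>h. sin (h * x)) has_real_derivative x) (at 0)"
        by (auto intro!: derivative_eq_intros)
      then have "((\<lambda>h. sin (h * x) / h) \<longlongrightarrow> x) (at 0)"
        by (simp add: DERIV_def)
      moreover have "filterlim e (at 0) sequentially"
        using e(1) e(3) by (intro filterlim_atI) (auto simp: less_imp_neq[symmetric] intro!: always_eventually)
      ultimately show ?thesis
        by (rule filterlim_compose)
    qed
    then show "(\<lambda>n. ennreal ((d x * (sin (e n * x) / e n))\<^sup>2)) \<longlonglongrightarrow> ennreal ((d x * x)\<^sup>2)"
      by (intro tendsto_intros tendsto_ennrealI)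
  qed simp
  moreover have "(\<integral>\<^sup>+x. ennreal ((d x)\<^sup>2) \<partial>lborel) \<le> ennreal (M / (2 * pi))"
    by (rule nn_integral_square_le_fourier[OF d M dM])
  moreover have "(\<integral>\<^sup>+x. ennreal ((1 + x\<^sup>2) * (d x)\<^sup>2) \<partial>lborel) =
      (\<integral>\<^sup>+x. ennreal ((d x)\<^sup>2) \<partial>lborel) + (\<integral>\<^sup>+x. ennreal ((d x * x)\<^sup>2) \<partial>lborel)"
    by (subst nn_integral_add[symmetric]) (auto simp: algebra_simps power_mult_distrib simp flip: ennreal_plus)
  moreover have "ennreal (M / pi) = ennreal (M / (2 * pi)) + ennreal (M / (2 * pi))"
    using M by (subst ennreal_plus[symmetric]) (auto simp: field_simps)
  ultimately show ?thesis
    by (simp add: add_mono)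
qed

section \<open>Two-point risk bound\<close>

text \<open>Product measures are determined by boxes, on which both the density and the indicator
  factor over the coordinates.\<close>

lemma PiM_density_eq:
  assumes I: "finite I" and P: "prob_space P" and Q: "prob_space (density P L)"
    and [measurable]: "L \<in> borel_measurable P"
  shows "(\<Pi>\<^sub>M i\<in>I. density P L) = density (\<Pi>\<^sub>M i\<in>I. P) (\<lambda>x. \<Prod>i\<in>I. L (x i))"
proof -
  interpret P: prob_space P by (fact P)
  interpret Q: prob_space "density P L" by (fact Q)
  interpret PP: product_sigma_finite "\<lambda>i. P" ..
  interpret QQ: product_sigma_finite "\<lambda>i. density P L" ..
  show ?thesis
  proof (rule QQ.PiM_eqI[OF I, symmetric])
    show "sets (density (\<Pi>\<^sub>M i\<in>I. P) (\<lambda>x. \<Prod>i\<in>I. L (x i))) = sets (\<Pi>\<^sub>M i\<in>I. density P L)"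
      by (simp cong: sets_PiM_cong)
    fix A assume "\<And>i. i \<in> I \<Longrightarrow> A i \<in> sets (density P L)"
    then have A[measurable]: "\<And>i. i \<in> I \<Longrightarrow> A i \<in> sets P"
      by simp
    have ind: "indicator (Pi\<^sub>E I A) x = (\<Prod>i\<in>I. indicator (A i) (x i) :: ennreal)"
      if "x \<in> space (\<Pi>\<^sub>M i\<in>I. P)" for x
      using that I by (auto simp: indicator_def space_PiM PiE_iff prod_zero_iff)
    have "emeasure (density (\<Pi>\<^sub>M i\<in>I. P) (\<lambda>x. \<Prod>i\<in>I. L (x i))) (Pi\<^sub>E I A) =
        (\<integral>\<^sup>+x. (\<Prod>i\<in>I. L (x i)) * indicator (Pi\<^sub>E I A) x \<partial>(\<Pi>\<^sub>M i\<in>I. P))"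
      using I by (subst emeasure_density) (auto intro!: sets_PiM_I_finite A)
    also have "\<dots> = (\<integral>\<^sup>+x. (\<Prod>i\<in>I. L (x i) * indicator (A i) (x i)) \<partial>(\<Pi>\<^sub>M i\<in>I. P))"
      by (intro nn_integral_cong) (simp add: ind prod.distrib)
    also have "\<dots> = (\<Prod>i\<in>I. \<integral>\<^sup>+x. L x * indicator (A i) x \<partial>P)"
      by (rule PP.product_nn_integral_prod[OF I]) simp
    also have "\<dots> = (\<Prod>i\<in>I. emeasure (density P L) (A i))"
      by (intro prod.cong refl) (simp add: emeasure_density)
    finally show "emeasure (density (\<Pi>\<^sub>M i\<in>I. P) (\<lambda>x. \<Prod>i\<in>I. L (x i))) (Pi\<^sub>E I A) =
        (\<Prod>i\<in>I. emeasure (density P L) (A i))" .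
  qed
qed

text \<open>\<open>S\<close> is any common bound of the two risks, possibly infinite, so a supremum
  of risks can be inserted directly. An excess A / n per observation is the scale at which the joint
  second moment stays bounded: (1 + A / n)^n \<le> exp A.\<close>

lemma two_point_risk_le:
  fixes P :: "real measure" and L :: "real \<Rightarrow> ennreal"
  assumes P: "prob_space P" and Q: "prob_space (density P L)" and sets_P[measurable_cong]: "sets P = sets borel"
    and [measurable]: "L \<in> borel_measurable borel"
    and n: "1 \<le> n" and A: "0 \<le> A" and L2: "(\<integral>\<^sup>+x. (L x)\<^sup>2 \<partial>P) \<le> ennreal (1 + A / real n)"
    and T: "T \<in> estimators n" and \<delta>: "0 \<le> \<delta>"
    and S0: "(\<integral>\<^sup>+x. ennreal ((T x - 0)\<^sup>2) \<partial>(\<Pi>\<^sub>M i\<in>{..<n}. P)) \<le> S"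
    and S1: "(\<integral>\<^sup>+x. ennreal ((T x - \<delta>)\<^sup>2) \<partial>(\<Pi>\<^sub>M i\<in>{..<n}. density P L)) \<le> S"
  shows "ennreal (\<delta>\<^sup>2 / (4 * exp A)) \<le> S"
proof -
  let ?I = "{..<n}"
  let ?P = "\<Pi>\<^sub>M i\<in>?I. P" and ?Q = "\<Pi>\<^sub>M i\<in>?I. density P L"
  interpret P: prob_space P by (fact P)
  interpret Q: prob_space "density P L" by (fact Q)
  interpret PP: product_prob_space "\<lambda>i. P" ?I ..
  interpret QQ: product_prob_space "\<lambda>i. density P L" ?I ..
  define LL where "LL x = (\<Prod>i\<in>?I. L (x i))" for x
  have PQ: "?Q = density ?P LL"
    unfolding LL_def by (rule PiM_density_eq[OF _ P Q]) auto
  have setsP[measurable_cong]: "sets ?P = sets (\<Pi>\<^sub>M i\<in>?I. borel)"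
    by (intro sets_PiM_cong) (auto simp: sets_P)
  have setsQ[measurable_cong]: "sets ?Q = sets (\<Pi>\<^sub>M i\<in>?I. borel)"
    by (intro sets_PiM_cong) (auto simp: sets_P)
  have T_meas[measurable]: "T \<in> borel_measurable (\<Pi>\<^sub>M i\<in>?I. borel)"
    using T by (simp add: estimators_def)
  have LL[measurable]: "LL \<in> borel_measurable (\<Pi>\<^sub>M i\<in>?I. borel)"
    unfolding LL_def by measurable
  \<comment> \<open>Independence: the second moment of the joint likelihood ratio is the n-th power
    of that of one observation.\<close>
  have "(\<integral>\<^sup>+x. (LL x)\<^sup>2 \<partial>?P) = (\<integral>\<^sup>+x. (\<Prod>i\<in>?I. (L (x i))\<^sup>2) \<partial>?P)"
    by (simp add: LL_def prod_power_distrib)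
  also have "\<dots> = (\<Prod>i\<in>?I. \<integral>\<^sup>+x. (L x)\<^sup>2 \<partial>P)"
    by (rule PP.product_nn_integral_prod) auto
  also have "\<dots> \<le> ennreal (1 + A / real n) ^ n"
    using L2 by (simp add: power_mono)
  also have "\<dots> = ennreal ((1 + A / real n) ^ n)"
    using A by (subst ennreal_power) auto
  also have "\<dots> \<le> ennreal (exp A)"
    using A n by (intro ennreal_leI exp_ge_one_plus_x_over_n_power_n) auto
  finally have LL2: "(\<integral>\<^sup>+x. (LL x)\<^sup>2 \<partial>?P) \<le> ennreal (exp A)" .
  define a where "a = (\<integral>\<^sup>+x. ennreal \<bar>T x - \<delta>\<bar> \<partial>?Q)"
  define b where "b = (\<integral>\<^sup>+x. ennreal \<bar>T x\<bar> \<partial>?Q)"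
  have "a\<^sup>2 = (\<integral>\<^sup>+x. ennreal \<bar>T x - \<delta>\<bar> * 1 \<partial>?Q)\<^sup>2"
    by (simp add: a_def)
  also have "\<dots> \<le> (\<integral>\<^sup>+x. (ennreal \<bar>T x - \<delta>\<bar>)\<^sup>2 \<partial>?Q) * (\<integral>\<^sup>+x. 1\<^sup>2 \<partial>?Q)"
    by (rule Cauchy_Schwarz_nn_integral) auto
  also have "\<dots> \<le> S"
    using S1 by (simp add: ennreal_power QQ.emeasure_space_1)
  \<comment> \<open>Weakened on purpose, so that \<open>a\<close> and \<open>b\<close> share one
    bound; a + b \<le> 2 max a b then gives the 4 in the conclusion.\<close>
  also have "S \<le> S * ennreal (exp A)"
    using A mult_left_mono[of 1 "ennreal (exp A)" S] by simp
  finally have a: "a\<^sup>2 \<le> S * ennreal (exp A)" .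
  have "b = (\<integral>\<^sup>+x. ennreal \<bar>T x\<bar> * LL x \<partial>?P)"
    unfolding b_def PQ by (subst nn_integral_density) (auto simp: mult.commute)
  then have "b\<^sup>2 \<le> (\<integral>\<^sup>+x. (ennreal \<bar>T x\<bar>)\<^sup>2 \<partial>?P) * (\<integral>\<^sup>+x. (LL x)\<^sup>2 \<partial>?P)"
    by (simp add: Cauchy_Schwarz_nn_integral)
  also have "\<dots> \<le> S * ennreal (exp A)"
    using S0 LL2 by (intro mult_mono) (auto simp: ennreal_power)
  finally have b: "b\<^sup>2 \<le> S * ennreal (exp A)" .
  have "ennreal \<delta> = (\<integral>\<^sup>+x. ennreal \<delta> \<partial>?Q)"
    by (simp add: QQ.emeasure_space_1)
  also have "\<dots> \<le> (\<integral>\<^sup>+x. ennreal \<bar>T x - \<delta>\<bar> + ennreal \<bar>T x\<bar> \<partial>?Q)"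
    using \<delta> by (intro nn_integral_mono) (auto simp flip: ennreal_plus intro!: ennreal_leI)
  also have "\<dots> = a + b"
    unfolding a_def b_def by (rule nn_integral_add) auto
  also have "\<dots> \<le> 2 * max a b"
    by (simp add: mult_2 add_mono)
  finally have "(ennreal \<delta>)\<^sup>2 \<le> (2 * max a b)\<^sup>2"
    by (rule power_mono) simp
  also have "\<dots> = 4 * (max a b)\<^sup>2"
    by (simp add: power_mult_distrib)
  also have "\<dots> \<le> 4 * (S * ennreal (exp A))"
    using a b by (intro mult_left_mono) (auto simp: max_def)
  also have "\<dots> = S * ennreal (4 * exp A)"
    by (simp add: ennreal_mult mult_ac)
  finally have "ennreal (\<delta>\<^sup>2) \<le> S * ennreal (4 * exp A)"
    using \<delta> by (simp add: ennreal_power)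
  then have "ennreal (\<delta>\<^sup>2) / ennreal (4 * exp A) \<le> S"
    by (subst divide_le_posI_ennreal) (auto simp: mult.commute)
  then show ?thesis
    by (subst (asm) divide_ennreal) auto
qed

section \<open>The law of the observations\<close>

lemma prob_density_integrable:
  assumes "prob_density f"
  shows "integrable lborel f" "(\<integral>x. f x \<partial>lborel) = 1"
proof -
  have f: "f \<in> borel_measurable borel" "\<And>x. 0 \<le> f x" "(\<integral>\<^sup>+x. ennreal (f x) \<partial>lborel) = 1"
    using assms by (auto simp: prob_density_def)
  show int: "integrable lborel f"
    using f by (intro integrableI_nonneg) auto
  show "(\<integral>x. f x \<partial>lborel) = 1"
    using f nn_integral_eq_integral[OF int] by (simp add: ennreal_eq_1)
qed

lemma prob_densityI:
  assumes "integrable lborel f" "\<And>x. 0 \<le> f x" "(\<integral>x. f x \<partial>lborel) = 1"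
  shows "prob_density f"
  using assms nn_integral_eq_integral[OF assms(1)] by (auto simp: prob_density_def)

lemma prob_density_of_prob_space:
  assumes "f \<in> borel_measurable borel" "\<And>x. 0 \<le> f x" "prob_space (density lborel f)"
  shows "prob_density f"
  using prob_space.emeasure_space_1[OF assms(3)] assms(1,2)
  by (simp add: prob_density_def emeasure_density)

text \<open>The convolution is a Bochner integral, hence 0 wherever it would diverge; for bounded
  \<open>f\<close> it converges at every point.\<close>

definition obs_density :: "(real \<Rightarrow> real) \<Rightarrow> real \<Rightarrow> (real \<Rightarrow> real) \<Rightarrow> real \<Rightarrow> real" where
  "obs_density k p f x = p * k x + (1 - p) * (\<integral>y. f (x - y) * k y \<partial>lborel)"

text \<open>Conditioning on A: with probability \<open>p\<close> only the noise is seen, otherwise V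
  + Z, whose law is a convolution. The integral in \<open>ennreal\<close> keeps the formula
  meaningful for unbounded \<open>f\<close>.\<close>

lemma obs_law_eq_mixture:
  assumes k: "prob_density k" and f: "prob_density f" and p: "0 \<le> p" "p \<le> 1"
  shows "obs_law k p f =
    density lborel (\<lambda>x. ennreal p * ennreal (k x) + ennreal (1 - p) * (\<integral>\<^sup>+y. ennreal (f (x - y)) * ennreal (k y) \<partial>lborel))"
    (is "_ = density lborel ?q")
proof -
  let ?V = "density lborel f" and ?Z = "density lborel k" and ?B = "measure_pmf (bernoulli_pmf (1 - p))"
  let ?fk = "\<lambda>x. \<integral>\<^sup>+y. ennreal (f (x - y)) * ennreal (k y) \<partial>lborel"
  interpret V: prob_space ?V by (rule prob_space_density_lborel[OF f])
  interpret Z: prob_space ?Z by (rule prob_space_density_lborel[OF k])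
  interpret VZ: pair_prob_space ?V ?Z ..
  interpret AVZ: pair_prob_space ?B "?V \<Otimes>\<^sub>M ?Z" ..
  have [measurable]: "f \<in> borel_measurable borel" "k \<in> borel_measurable borel"
    using k f by (auto simp: prob_density_def)
  have "(\<lambda>(a, v, z). of_bool a * v + z :: real) \<in> borel_measurable (count_space UNIV \<Otimes>\<^sub>M (borel \<Otimes>\<^sub>M borel))"
    by measurable
  moreover have "sets (?B \<Otimes>\<^sub>M (?V \<Otimes>\<^sub>M ?Z)) = sets (count_space UNIV \<Otimes>\<^sub>M (borel \<Otimes>\<^sub>M borel))"
    by (intro sets_pair_measure_cong) auto
  ultimately have X[measurable]: "(\<lambda>(a, v, z). of_bool a * v + z :: real) \<in> borel_measurable (?B \<Otimes>\<^sub>M (?V \<Otimes>\<^sub>M ?Z))"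
    by (simp cong: measurable_cong_sets)
  show ?thesis
  proof (rule measure_eqI)
    show "sets (obs_law k p f) = sets (density lborel ?q)"
      by (simp add: obs_law_def)
    fix A assume "A \<in> sets (obs_law k p f)"
    then have A[measurable]: "A \<in> sets borel"
      by (simp add: obs_law_def)
    have "emeasure (obs_law k p f) A = (\<integral>\<^sup>+x. indicator A x \<partial>obs_law k p f)"
      by (simp add: obs_law_def)
    also have "\<dots> = (\<integral>\<^sup>+w. indicator A (case w of (a, v, z) \<Rightarrow> of_bool a * v + z) \<partial>(?B \<Otimes>\<^sub>M (?V \<Otimes>\<^sub>M ?Z)))"
      unfolding obs_law_def by (rule nn_integral_distr[OF X]) simp
    also have "\<dots> = (\<integral>\<^sup>+a. \<integral>\<^sup>+w. indicator A (case w of (v, z) \<Rightarrow> of_bool a * v + z) \<partial>(?V \<Otimes>\<^sub>M ?Z) \<partial>?B)"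
      by (subst VZ.P.nn_integral_fst[symmetric]) (auto simp: split_beta')
    also have "\<dots> = (\<integral>\<^sup>+w. indicator A (case w of (v, z) \<Rightarrow> v + z) \<partial>(?V \<Otimes>\<^sub>M ?Z)) * ennreal (1 - p) +
        (\<integral>\<^sup>+w. indicator A (snd w) \<partial>(?V \<Otimes>\<^sub>M ?Z)) * ennreal p"
      using p by (simp add: split_beta')
    also have "(\<integral>\<^sup>+w. indicator A (case w of (v, z) \<Rightarrow> v + z) \<partial>(?V \<Otimes>\<^sub>M ?Z)) = emeasure (?V \<star> ?Z) A"
      using nn_integral_distr[of "\<lambda>(v, z). v + z" "?V \<Otimes>\<^sub>M ?Z" borel "indicator A"]
      unfolding convolution_def by simp
    also have "?V \<star> ?Z = density lborel (\<lambda>x. \<integral>\<^sup>+y. ennreal (f (x - y)) * ennreal (k y) \<partial>lborel)"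
      by (rule convolution_density) (auto intro: V.finite_measure_axioms Z.finite_measure_axioms)
    also have "(\<integral>\<^sup>+w. indicator A (snd w) \<partial>(?V \<Otimes>\<^sub>M ?Z)) = emeasure ?Z A"
      by (subst Z.nn_integral_fst[symmetric]) (auto simp: V.emeasure_space_1[simplified])
    finally have lhs: "emeasure (obs_law k p f) A = emeasure (density lborel ?fk) A * ennreal (1 - p) + emeasure ?Z A * ennreal p" .
    have "emeasure (density lborel ?q) A =
        (\<integral>\<^sup>+x. ennreal p * (ennreal (k x) * indicator A x) + ennreal (1 - p) * (?fk x * indicator A x) \<partial>lborel)"
      by (subst emeasure_density) (auto simp: distrib_right mult.assoc)
    also have "\<dots> = ennreal p * emeasure ?Z A + ennreal (1 - p) * emeasure (density lborel ?fk) A"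
      by (subst nn_integral_add) (auto simp: nn_integral_cmult emeasure_density)
    finally show "emeasure (obs_law k p f) A = emeasure (density lborel ?q) A"
      unfolding lhs by (simp only: mult.commute add.commute)
  qed
qed

text \<open>The bound \<open>B\<close> makes the convolution finite at every point, so the law has a
  real-valued density; its normalisation is read off from the total mass of the law.\<close>

lemma obs_law_eq_density:
  assumes k: "prob_density k" and f: "prob_density f" and p: "0 \<le> p" "p \<le> 1" and B: "\<And>x. f x \<le> B"
  shows "obs_law k p f = density lborel (obs_density k p f)" and "prob_density (obs_density k p f)"
proof -
  have f': "f \<in> borel_measurable borel" "\<And>x. 0 \<le> f x" and k': "k \<in> borel_measurable borel" "\<And>x. 0 \<le> k x"
    using k f by (auto simp: prob_density_def)
  note [measurable] = f'(1) k'(1)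
  have "0 \<le> B"
    using B[of 0] f'(2)[of 0] by linarith
  have int: "integrable lborel (\<lambda>y. f (x - y) * k y)" for x
  proof (rule Bochner_Integration.integrable_bound)
    show "integrable lborel (\<lambda>y. B * k y)"
      using prob_density_integrable[OF k] by simp
    show "AE y in lborel. norm (f (x - y) * k y) \<le> norm (B * k y)"
      using f'(2) k'(2) B \<open>0 \<le> B\<close> by (intro AE_I2) (auto simp: abs_mult intro!: mult_right_mono)
  qed simp
  have nonneg: "0 \<le> (\<integral>y. f (x - y) * k y \<partial>lborel)" for x
    using f'(2) k'(2) by (intro integral_nonneg_AE AE_I2) auto
  have "ennreal p * ennreal (k x) + ennreal (1 - p) * (\<integral>\<^sup>+y. ennreal (f (x - y)) * ennreal (k y) \<partial>lborel)
      = ennreal (obs_density k p f x)" for x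
  proof -
    have "(\<integral>\<^sup>+y. ennreal (f (x - y)) * ennreal (k y) \<partial>lborel) = ennreal (\<integral>y. f (x - y) * k y \<partial>lborel)"
      using f'(2) k'(2) by (subst nn_integral_eq_integral[symmetric, OF int]) (auto simp: ennreal_mult)
    then show ?thesis
      using p k'(2) nonneg by (simp add: obs_density_def ennreal_plus ennreal_mult)
  qed
  then show eq: "obs_law k p f = density lborel (obs_density k p f)"
    by (simp add: obs_law_eq_mixture[OF k f p])
  show "prob_density (obs_density k p f)"
  proof (rule prob_density_of_prob_space)
    show "obs_density k p f \<in> borel_measurable borel"
      unfolding obs_density_def by measurable
    show "0 \<le> obs_density k p f x" for x
      using p k'(2) nonneg by (simp add: obs_density_def)
    show "prob_space (density lborel (obs_density k p f))"
      using prob_space_obs_law[OF k f, of p] eq by simp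
  qed
qed

text \<open>Independence factors the transform once A is fixed. For A = 0 the factor of V is its
  characteristic function at 0, which is 1; hence the constant term \<open>p\<close>.\<close>

lemma char_obs_law:
  assumes k: "prob_density k" and f: "prob_density f" and p: "0 \<le> p" "p \<le> 1"
  shows "char (obs_law k p f) t = (p + (1 - p) * fourier f t) * char (density lborel k) t"
proof -
  let ?V = "density lborel f" and ?Z = "density lborel k" and ?B = "measure_pmf (bernoulli_pmf (1 - p))"
  interpret V: prob_space ?V by (rule prob_space_density_lborel[OF f])
  interpret Z: prob_space ?Z by (rule prob_space_density_lborel[OF k])
  interpret VZ: pair_prob_space ?V ?Z ..
  interpret AVZ: pair_prob_space ?B "?V \<Otimes>\<^sub>M ?Z" ..
  have [measurable]: "f \<in> borel_measurable borel" "k \<in> borel_measurable borel"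
    using k f by (auto simp: prob_density_def)
  have "(\<lambda>(a, v, z). of_bool a * v + z :: real) \<in> borel_measurable (count_space UNIV \<Otimes>\<^sub>M (borel \<Otimes>\<^sub>M borel))"
    by measurable
  moreover have "sets (?B \<Otimes>\<^sub>M (?V \<Otimes>\<^sub>M ?Z)) = sets (count_space UNIV \<Otimes>\<^sub>M (borel \<Otimes>\<^sub>M borel))"
    by (intro sets_pair_measure_cong) auto
  ultimately have X[measurable]: "(\<lambda>(a, v, z). of_bool a * v + z :: real) \<in> borel_measurable (?B \<Otimes>\<^sub>M (?V \<Otimes>\<^sub>M ?Z))"
    by (simp cong: measurable_cong_sets)
  have VZ: "(\<integral>w. iexp (t * (c * fst w + snd w)) \<partial>(?V \<Otimes>\<^sub>M ?Z)) = char ?V (t * c) * char ?Z t" for c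
  proof -
    have "(\<integral>w. iexp (t * (c * fst w + snd w)) \<partial>(?V \<Otimes>\<^sub>M ?Z)) = (\<integral>v. \<integral>z. iexp (t * (c * v + z)) \<partial>?Z \<partial>?V)"
      by (subst VZ.integral_fst'[symmetric]) (auto intro!: VZ.P.integrable_const_bound[where B = 1])
    also have "\<dots> = (\<integral>v. iexp ((t * c) * v) * char ?Z t \<partial>?V)"
    proof (rule Bochner_Integration.integral_cong[OF refl])
      fix v
      have "(\<integral>z. iexp (t * (c * v + z)) \<partial>?Z) = (\<integral>z. iexp ((t * c) * v) * iexp (t * z) \<partial>?Z)"
        by (rule Bochner_Integration.integral_cong) (auto simp: algebra_simps simp flip: exp_add)
      then show "(\<integral>z. iexp (t * (c * v + z)) \<partial>?Z) = iexp ((t * c) * v) * char ?Z t"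
        unfolding char_def by (simp only: integral_mult_right_zero)
    qed
    also have "\<dots> = char ?V (t * c) * char ?Z t"
      by (simp add: char_def)
    finally show ?thesis .
  qed
  have "char (obs_law k p f) t = (\<integral>w. iexp (t * (case w of (a, v, z) \<Rightarrow> of_bool a * v + z)) \<partial>(?B \<Otimes>\<^sub>M (?V \<Otimes>\<^sub>M ?Z)))"
    unfolding char_def obs_law_def by (rule integral_distr[OF X]) simp
  also have "\<dots> = (\<integral>a. \<integral>w. iexp (t * (of_bool a * fst w + snd w)) \<partial>(?V \<Otimes>\<^sub>M ?Z) \<partial>?B)"
    by (subst AVZ.integral_fst'[symmetric])
       (auto intro!: AVZ.P.integrable_const_bound[where B = 1] simp: split_beta')
  also have "\<dots> = (1 - p) * (char ?V t * char ?Z t) + p * (char ?V 0 * char ?Z t)"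
    unfolding VZ using p by (subst integral_measure_pmf[of UNIV]) (auto simp: UNIV_bool scaleR_conv_of_real)
  also have "char ?V 0 = 1"
    using V.prob_space by (simp add: char_def)
  finally show ?thesis
    using f by (simp add: char_density_eq_fourier prob_density_def algebra_simps)
qed

text \<open>A chi-square computation: q1^2 / q0 has integral 1 plus that of (q0 - q1)^2 / q0, and
  the lower bound on \<open>q0\<close> turns 1 / q0 into the weight (1 + x^2) / c, which matches the
  weighted Plancherel inequality.\<close>

lemma density_ratio_second_moment:
  assumes q0: "prob_density q0" and q1: "prob_density q1" and c: "0 < c" and W: "0 \<le> W"
    and low: "\<And>x. c / (1 + x\<^sup>2) \<le> q0 x"
    and le: "(\<integral>\<^sup>+x. ennreal ((1 + x\<^sup>2) * (q0 x - q1 x)\<^sup>2) \<partial>lborel) \<le> ennreal W"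
  shows "density (density lborel q0) (\<lambda>x. ennreal (q1 x / q0 x)) = density lborel q1"
    and "(\<integral>\<^sup>+x. (ennreal (q1 x / q0 x))\<^sup>2 \<partial>density lborel q0) \<le> ennreal (1 + W / c)"
proof -
  have q0': "q0 \<in> borel_measurable borel" "(\<integral>\<^sup>+x. ennreal (q0 x) \<partial>lborel) = 1"
    and q1': "q1 \<in> borel_measurable borel" "(\<integral>\<^sup>+x. ennreal (q1 x) \<partial>lborel) = 1" "\<And>x. 0 \<le> q1 x"
    using q0 q1 by (auto simp: prob_density_def)
  note [measurable] = q0'(1) q1'(1)
  have pos: "0 < q0 x" for x
    using c by (intro less_le_trans[OF _ low]) (auto intro!: divide_pos_pos add_pos_nonneg)
  have "ennreal (q0 x) * ennreal (q1 x / q0 x) = ennreal (q1 x)" for x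
    using pos[of x] q1'(3)[of x] by (simp flip: ennreal_mult)
  then show "density (density lborel q0) (\<lambda>x. ennreal (q1 x / q0 x)) = density lborel q1"
    by (subst density_density_eq) auto
  define Y where "Y = (\<integral>\<^sup>+x. ennreal ((q0 x - q1 x)\<^sup>2 / q0 x) \<partial>lborel)"
  define X where "X = (\<integral>\<^sup>+x. (ennreal (q1 x / q0 x))\<^sup>2 \<partial>density lborel q0)"
  have "X = (\<integral>\<^sup>+x. ennreal ((q1 x)\<^sup>2 / q0 x) \<partial>lborel)"
    unfolding X_def
  proof (subst nn_integral_density, simp, simp, intro nn_integral_cong)
    fix x
    have "q0 x * (q1 x / q0 x)\<^sup>2 = (q1 x)\<^sup>2 / q0 x"
      using pos[of x] by (simp add: field_simps power2_eq_square)
    then show "ennreal (q0 x) * (ennreal (q1 x / q0 x))\<^sup>2 = ennreal ((q1 x)\<^sup>2 / q0 x)"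
      using pos[of x] q1'(3)[of x] by (simp add: ennreal_power flip: ennreal_mult)
  qed
  \<comment> \<open>Adding \<open>q0\<close> avoids subtraction, so the pointwise identity can be
    integrated in \<open>ennreal\<close> before \<open>X\<close> is known to be finite.\<close>
  then have "X + 1 = (\<integral>\<^sup>+x. ennreal ((q1 x)\<^sup>2 / q0 x) + ennreal (q0 x) \<partial>lborel)"
    by (simp add: nn_integral_add q0'(2))
  also have "\<dots> = (\<integral>\<^sup>+x. (ennreal (q1 x) + ennreal (q1 x)) + ennreal ((q0 x - q1 x)\<^sup>2 / q0 x) \<partial>lborel)"
  proof (intro nn_integral_cong)
    fix x
    have "(q1 x)\<^sup>2 / q0 x + q0 x = (q1 x + q1 x) + (q0 x - q1 x)\<^sup>2 / q0 x"
      using pos[of x] by (simp add: field_simps power2_eq_square)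
    then show "ennreal ((q1 x)\<^sup>2 / q0 x) + ennreal (q0 x) =
        (ennreal (q1 x) + ennreal (q1 x)) + ennreal ((q0 x - q1 x)\<^sup>2 / q0 x)"
      using pos[of x] q1'(3)[of x] by (simp flip: ennreal_plus)
  qed
  also have "\<dots> = (1 + 1) + Y"
    by (simp add: nn_integral_add q1'(2) Y_def)
  finally have "1 + X = 1 + (1 + Y)"
    by (simp add: add_ac)
  then have "X = 1 + Y"
    by (simp only: ennreal_add_left_cancel) simp
  also have "Y \<le> (\<integral>\<^sup>+x. ennreal (1 / c) * ennreal ((1 + x\<^sup>2) * (q0 x - q1 x)\<^sup>2) \<partial>lborel)"
    unfolding Y_def
  proof (intro nn_integral_mono)
    fix x
    have "(q0 x - q1 x)\<^sup>2 / q0 x \<le> (q0 x - q1 x)\<^sup>2 / (c / (1 + x\<^sup>2))"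
      using c by (intro divide_left_mono low mult_pos_pos pos) (auto intro!: divide_pos_pos add_pos_nonneg)
    also have "\<dots> = 1 / c * ((1 + x\<^sup>2) * (q0 x - q1 x)\<^sup>2)"
      by simp
    finally show "ennreal ((q0 x - q1 x)\<^sup>2 / q0 x) \<le> ennreal (1 / c) * ennreal ((1 + x\<^sup>2) * (q0 x - q1 x)\<^sup>2)"
      using c by (subst ennreal_mult[symmetric]) (auto intro!: ennreal_leI)
  qed
  also have "\<dots> \<le> ennreal (1 / c) * ennreal W"
    by (subst nn_integral_cmult) (auto intro!: mult_left_mono le)
  also have "\<dots> = ennreal (W / c)"
    using c W by (subst ennreal_mult[symmetric]) auto
  finally show "(\<integral>\<^sup>+x. (ennreal (q1 x / q0 x))\<^sup>2 \<partial>density lborel q0) \<le> ennreal (1 + W / c)"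
    using c W by (simp add: X_def)
qed

section \<open>A heavy-tailed Gaussian mixture\<close>

lemma normal_density_le:
  assumes "0 < \<sigma>"
  shows "normal_density 0 \<sigma> x \<le> 1 / \<sigma>"
proof -
  have "1 \<le> sqrt (2 * pi)"
    using pi_gt3 by (simp add: real_le_rsqrt)
  then have "1 * \<sigma> \<le> sqrt (2 * pi) * \<sigma>"
    using assms by (intro mult_right_mono) auto
  then have "1 / (sqrt (2 * pi) * \<sigma>) * exp (- x\<^sup>2 / (2 * \<sigma>\<^sup>2)) \<le> 1 / \<sigma> * 1"
    using assms by (intro mult_mono) (auto intro!: divide_left_mono)
  then show ?thesis
    using assms by (simp add: normal_density_def real_sqrt_mult)
qed

text \<open>A Gaussian scale mixture with tails of exact order \<open>1 / x\<^sup>2\<close>, the lightest ones that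
  the single derivative of the noise characteristic function can handle.\<close>

definition heavy_density :: "real \<Rightarrow> real \<Rightarrow> real" where
  "heavy_density s x = (\<Sum>n. (1 / 2) ^ Suc n * normal_density 0 (s * 2 ^ n) x)"

context
  fixes s :: real
  assumes s: "1 \<le> s"
begin

lemma heavy_scale_ge_1: "1 \<le> s * 2 ^ n"
  using s mult_mono[of 1 s 1 "2 ^ n"] by simp

lemma heavy_term_le: "(1 / 2) ^ Suc n * normal_density 0 (s * 2 ^ n) x \<le> (1 / 2) ^ Suc n"
proof -
  have "normal_density 0 (s * 2 ^ n) x \<le> 1 / (s * 2 ^ n)"
    using heavy_scale_ge_1[of n] by (intro normal_density_le) linarith
  also have "\<dots> \<le> 1"
    using heavy_scale_ge_1[of n] by simp
  finally show ?thesis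
    by (intro mult_left_le) auto
qed

lemma summable_heavy: "summable (\<lambda>n. (1 / 2) ^ Suc n * normal_density 0 (s * 2 ^ n) x)"
  by (rule summable_comparison_test'[OF sums_summable[OF power_half_series]])
     (use heavy_term_le in auto)

lemma heavy_density_nonneg: "0 \<le> heavy_density s x"
  unfolding heavy_density_def by (intro suminf_nonneg summable_heavy) auto

lemma heavy_density_le_1: "heavy_density s x \<le> 1"
proof -
  have "heavy_density s x \<le> (\<Sum>n. (1 / 2) ^ Suc n)"
    unfolding heavy_density_def
    by (intro suminf_le summable_heavy heavy_term_le sums_summable[OF power_half_series])
  then show ?thesis
    using sums_unique[OF power_half_series] by simp
qed

lemma heavy_density_integrable: "integrable lborel (heavy_density s)"
  and heavy_density_integral: "(\<integral>x. heavy_density s x \<partial>lborel) = 1"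
proof -
  have int_eq: "(\<integral>x. (1 / 2) ^ Suc n * normal_density 0 (s * 2 ^ n) x \<partial>lborel) = (1 / 2) ^ Suc n" for n
    using heavy_scale_ge_1[of n] by (simp add: less_le_trans[OF zero_less_one])
  have int: "integrable lborel (\<lambda>x. (1 / 2) ^ Suc n * normal_density 0 (s * 2 ^ n) x)" for n
    using heavy_scale_ge_1[of n] by (intro integrable_mult_right integrable_normal_density) linarith
  have sm: "AE x in lborel. summable (\<lambda>n. norm ((1 / 2) ^ Suc n * normal_density 0 (s * 2 ^ n) x))"
    using summable_heavy by simp
  have si: "summable (\<lambda>n. \<integral>x. norm ((1 / 2) ^ Suc n * normal_density 0 (s * 2 ^ n) x) \<partial>lborel)"
    using sums_summable[OF power_half_series] int_eq by simp
  show "integrable lborel (heavy_density s)"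
    unfolding heavy_density_def by (rule integrable_suminf[OF int sm si])
  have "(\<lambda>n. (1 / 2) ^ Suc n) sums (\<integral>x. heavy_density s x \<partial>lborel)"
    using sums_integral[OF int sm si] unfolding int_eq heavy_density_def .
  then show "(\<integral>x. heavy_density s x \<partial>lborel) = 1"
    using power_half_series sums_unique2 by blast
qed

text \<open>Every component has scale at least \<open>s\<close>, so its transform is below that of
  scale \<open>s\<close>, and the weights sum to 1. A large \<open>s\<close> thus concentrates the
  transform near 0 and makes the Sobolev energy small.\<close>

lemma norm_fourier_heavy_density_le: "cmod (fourier (heavy_density s) t) \<le> exp (- (s\<^sup>2 * t\<^sup>2 / 2))"
proof -
  define f where "f n x = iexp (t * x) * complex_of_real ((1 / 2) ^ Suc n * normal_density 0 (s * 2 ^ n) x)" for n x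
  have pos: "0 < s * 2 ^ n" for n
    using heavy_scale_ge_1[of n] by linarith
  have int: "integrable lborel (f n)" for n
    unfolding f_def using pos by (intro integrable_iexp_mult integrable_mult_right integrable_normal_density)
  have norm_f: "norm (f n x) = (1 / 2) ^ Suc n * normal_density 0 (s * 2 ^ n) x" for n x
    by (simp add: f_def norm_mult norm_power norm_divide)
  have f_int: "(\<integral>x. f n x \<partial>lborel) = complex_of_real ((1 / 2) ^ Suc n * exp (- ((s * 2 ^ n)\<^sup>2 * t\<^sup>2 / 2)))" for n
  proof -
    have "(\<integral>x. f n x \<partial>lborel) = (1 / 2) ^ Suc n * fourier (normal_density 0 (s * 2 ^ n)) t"
      unfolding fourier_def f_def by (simp add: mult_ac flip: integral_mult_right_zero)
    then show ?thesis
      by (simp add: fourier_normal_density[OF pos])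
  qed
  have "(\<lambda>n. \<integral>x. f n x \<partial>lborel) sums (\<integral>x. (\<Sum>n. f n x) \<partial>lborel)"
  proof (rule sums_integral[OF int])
    show "AE x in lborel. summable (\<lambda>n. norm (f n x))"
      unfolding norm_f using summable_heavy by simp
    show "summable (\<lambda>n. \<integral>x. norm (f n x) \<partial>lborel)"
      unfolding norm_f using sums_summable[OF power_half_series] pos by simp
  qed
  also have "(\<integral>x. (\<Sum>n. f n x) \<partial>lborel) = fourier (heavy_density s) t"
    unfolding fourier_def heavy_density_def f_def
    by (intro Bochner_Integration.integral_cong refl)
       (subst suminf_mult[OF summable_of_real[OF summable_heavy]],
        subst suminf_of_real[OF summable_heavy], simp)
  finally have sums: "(\<lambda>n. \<integral>x. f n x \<partial>lborel) sums fourier (heavy_density s) t" .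
  have le: "norm (\<integral>x. f n x \<partial>lborel) \<le> (1 / 2) ^ Suc n * exp (- (s\<^sup>2 * t\<^sup>2 / 2))" for n
  proof -
    have "s * 1 \<le> s * 2 ^ n"
      using s by (intro mult_left_mono) auto
    then have "s\<^sup>2 \<le> (s * 2 ^ n)\<^sup>2"
      using s by (intro power_mono) auto
    then have "s\<^sup>2 * t\<^sup>2 \<le> (s * 2 ^ n)\<^sup>2 * t\<^sup>2"
      by (intro mult_right_mono) auto
    then show ?thesis
      unfolding f_int norm_of_real by (simp add: abs_mult)
  qed
  have bsums: "(\<lambda>n. (1 / 2) ^ Suc n * exp (- (s\<^sup>2 * t\<^sup>2 / 2))) sums (1 * exp (- (s\<^sup>2 * t\<^sup>2 / 2)))"
    by (intro sums_mult2 power_half_series)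
  have "norm (\<Sum>n. \<integral>x. f n x \<partial>lborel) \<le> (\<Sum>n. (1 / 2) ^ Suc n * exp (- (s\<^sup>2 * t\<^sup>2 / 2)))"
    by (rule norm_suminf_le[OF le sums_summable[OF bsums]])
  then show ?thesis
    using sums_unique[OF sums] sums_unique[OF bsums] by simp
qed

text \<open>One component is enough: the one with 2^n comparable to max 1 (|x| / s). There |x| is at
  most two standard deviations, which costs exp (- 2), while weight and height together give 4^(-n),
  at least 1 / (1 + x^2), up to the constant in front.\<close>

lemma heavy_density_ge:
  "exp (- 2) / (2 * s * sqrt (2 * pi)) / (1 + x\<^sup>2) \<le> heavy_density s x"
proof -
  define y where "y = max 1 (\<bar>x\<bar> / s)"
  have "1 \<le> y"
    by (simp add: y_def)
  obtain n :: nat where n: "2 ^ n \<le> y" "y < 2 ^ Suc n"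
  proof -
    define n where "n = nat \<lfloor>log 2 y\<rfloor>"
    have "0 \<le> log 2 y"
      using \<open>1 \<le> y\<close> by simp
    then have "real n \<le> log 2 y" "log 2 y < real (Suc n)"
      unfolding n_def by linarith+
    then have "2 powr real n \<le> y" "y < 2 powr real (Suc n)"
      using \<open>1 \<le> y\<close> by (simp_all add: le_log_iff log_less_iff del: of_nat_Suc)
    then show ?thesis
      by (intro that[of n]) (simp_all add: powr_realpow del: of_nat_Suc)
  qed
  let ?\<sigma> = "s * 2 ^ n"
  have \<sigma>: "0 < ?\<sigma>"
    using heavy_scale_ge_1[of n] by linarith
  have "\<bar>x\<bar> / s \<le> 2 * 2 ^ n"
    using n by (simp add: y_def)
  then have "\<bar>x\<bar> \<le> 2 * ?\<sigma>"
    using s by (simp add: field_simps)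
  from power_mono[OF this, of 2] have "x\<^sup>2 \<le> (2 * ?\<sigma>)\<^sup>2"
    by simp
  moreover have "0 < 2 * ?\<sigma>\<^sup>2"
    using s by simp
  ultimately have "x\<^sup>2 / (2 * ?\<sigma>\<^sup>2) \<le> 2"
    by (subst pos_divide_le_eq) (auto simp: power_mult_distrib)
  then have e: "exp (- 2) \<le> exp (- x\<^sup>2 / (2 * ?\<sigma>\<^sup>2))"
    by simp
  have "y\<^sup>2 \<le> 1 + x\<^sup>2"
  proof (cases "\<bar>x\<bar> / s \<le> 1")
    case False
    then have "y = \<bar>x\<bar> / s" by (simp add: y_def)
    moreover have "(\<bar>x\<bar> / s)\<^sup>2 \<le> \<bar>x\<bar>\<^sup>2"
      using s divide_left_mono[of 1 s "\<bar>x\<bar>"] by (intro power_mono) auto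
    ultimately show ?thesis by simp
  qed (simp add: y_def)
  moreover have "(2 ^ n)\<^sup>2 \<le> y\<^sup>2"
    using n by (intro power_mono) auto
  ultimately have q: "(2 ^ n)\<^sup>2 \<le> 1 + x\<^sup>2"
    by linarith
  have "exp (- 2) / (2 * s * sqrt (2 * pi)) / (1 + x\<^sup>2) \<le> exp (- 2) / (2 * s * sqrt (2 * pi)) / (2 ^ n)\<^sup>2"
    using q s by (intro divide_left_mono) (auto intro!: mult_pos_pos add_pos_nonneg)
  also have "\<dots> = (1 / 2) ^ Suc n * (1 / (sqrt (2 * pi) * ?\<sigma>) * exp (- 2))"
    by (simp add: power_divide power2_eq_square)
  also have "\<dots> \<le> (1 / 2) ^ Suc n * (1 / (sqrt (2 * pi) * ?\<sigma>) * exp (- x\<^sup>2 / (2 * ?\<sigma>\<^sup>2)))"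
    using \<sigma> e by (intro mult_left_mono) auto
  also have "\<dots> = (1 / 2) ^ Suc n * normal_density 0 ?\<sigma> x"
    using \<sigma> by (simp add: normal_density_def real_sqrt_mult)
  also have "\<dots> \<le> heavy_density s x"
    unfolding heavy_density_def
    using sum_le_suminf[OF summable_heavy, of "{n}" x] by simp
  finally show ?thesis .
qed

end

section \<open>Sobolev bounds for contaminated mixtures\<close>

text \<open>|t|^(2\<alpha>) is at most 1 + |t|^N for an integer N \<ge> 2\<alpha>, which reduces the
  claim to an integer absolute moment of a Gaussian.\<close>

lemma nn_integral_gaussian_powr_finite:
  assumes "0 < \<alpha>"
  shows "(\<integral>\<^sup>+t. ennreal (exp (- t\<^sup>2) * (1 + \<bar>t\<bar> powr (2 * \<alpha>))) \<partial>lborel) < \<infinity>"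
proof -
  define N where "N = nat \<lceil>2 * \<alpha>\<rceil>"
  \<comment> \<open>With variance 1/2, exp (- t^2) is exactly sqrt pi times a normal
    density.\<close>
  define \<sigma> :: real where "\<sigma> = sqrt (1 / 2)"
  have \<sigma>: "0 < \<sigma>" "\<sigma>\<^sup>2 = 1 / 2"
    by (simp_all add: \<sigma>_def)
  define C where "C = sqrt pi"
  have eq: "exp (- t\<^sup>2) = C * normal_density 0 \<sigma> t" for t
    by (simp add: normal_density_def \<sigma> C_def)
  have "integrable lborel (\<lambda>t. 2 * C * normal_density 0 \<sigma> t + C * (normal_density 0 \<sigma> t * \<bar>t - 0\<bar> ^ N))"
    using \<sigma> by (intro Bochner_Integration.integrable_add integrable_mult_right integrable_normal_moment_abs
        integrable_normal_density) auto
  then have "integrable lborel (\<lambda>t. exp (- t\<^sup>2) * (1 + \<bar>t\<bar> powr (2 * \<alpha>)))"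
  proof (rule Bochner_Integration.integrable_bound)
    show "AE t in lborel. norm (exp (- t\<^sup>2) * (1 + \<bar>t\<bar> powr (2 * \<alpha>)))
        \<le> norm (2 * C * normal_density 0 \<sigma> t + C * (normal_density 0 \<sigma> t * \<bar>t - 0\<bar> ^ N))"
    proof (rule AE_I2)
      fix t
      have "\<bar>t\<bar> powr (2 * \<alpha>) \<le> 1 + \<bar>t\<bar> ^ N"
      proof (cases "\<bar>t\<bar> \<le> 1")
        case True
        then have "\<bar>t\<bar> powr (2 * \<alpha>) \<le> 1 powr (2 * \<alpha>)"
          using assms by (intro powr_mono2) auto
        then show ?thesis by (simp add: add_increasing2)
      next
        case False
        then have "\<bar>t\<bar> powr (2 * \<alpha>) \<le> \<bar>t\<bar> powr (real N)"
          unfolding N_def by (intro powr_mono) linarith+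
        also have "\<dots> = \<bar>t\<bar> ^ N"
          using False by (intro powr_realpow) linarith
        finally show ?thesis by simp
      qed
      then have "exp (- t\<^sup>2) * (1 + \<bar>t\<bar> powr (2 * \<alpha>)) \<le> exp (- t\<^sup>2) * (2 + \<bar>t\<bar> ^ N)"
        by (intro mult_left_mono) auto
      also have "\<dots> = 2 * C * normal_density 0 \<sigma> t + C * (normal_density 0 \<sigma> t * \<bar>t - 0\<bar> ^ N)"
        unfolding eq by (simp add: algebra_simps)
      finally show "norm (exp (- t\<^sup>2) * (1 + \<bar>t\<bar> powr (2 * \<alpha>)))
          \<le> norm (2 * C * normal_density 0 \<sigma> t + C * (normal_density 0 \<sigma> t * \<bar>t - 0\<bar> ^ N))"
        by (simp add: abs_mult)
    qed
  qed simp
  then show ?thesis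
    by (subst nn_integral_eq_integral) auto
qed

text \<open>The Sobolev integral of the standard normal density, whose squared transform is exp (-
  t^2). It is finite for \<alpha> > 0, so \<open>enn2real\<close> loses nothing there.\<close>

definition gaussian_sobolev :: "real \<Rightarrow> real" where
  "gaussian_sobolev \<alpha> = enn2real (\<integral>\<^sup>+t. ennreal (exp (- t\<^sup>2) * (1 + \<bar>t\<bar> powr (2 * \<alpha>))) \<partial>lborel)"

lemma gaussian_sobolev_nonneg: "0 \<le> gaussian_sobolev \<alpha>"
  by (simp add: gaussian_sobolev_def)

text \<open>\<open>B\<close> stands for a bound on both 1 and b^(-2\<alpha>), so that one statement
  serves the wide scale b = s with B = 1 and the narrow scale b = 1 / m with B =
  m^(2\<alpha>).\<close>

lemma nn_integral_gaussian_powr_scale_le: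
  assumes \<alpha>: "0 < \<alpha>" and b: "0 < b" and B: "1 \<le> B" "b powr (- (2 * \<alpha>)) \<le> B"
  shows "(\<integral>\<^sup>+t. ennreal (exp (- (b * t)\<^sup>2) * (1 + \<bar>t\<bar> powr (2 * \<alpha>))) \<partial>lborel)
    \<le> ennreal (B / b * gaussian_sobolev \<alpha>)"
proof -
  have "(\<integral>\<^sup>+t. ennreal (exp (- (b * t)\<^sup>2) * (1 + \<bar>t\<bar> powr (2 * \<alpha>))) \<partial>lborel) =
      \<bar>1 / b\<bar> * (\<integral>\<^sup>+t. ennreal (exp (- (b * (0 + 1 / b * t))\<^sup>2) * (1 + \<bar>0 + 1 / b * t\<bar> powr (2 * \<alpha>))) \<partial>lborel)"
    using b by (intro nn_integral_real_affine) auto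
  also have "\<dots> \<le> \<bar>1 / b\<bar> * (\<integral>\<^sup>+t. ennreal B * ennreal (exp (- t\<^sup>2) * (1 + \<bar>t\<bar> powr (2 * \<alpha>))) \<partial>lborel)"
  proof (intro mult_left_mono nn_integral_mono)
    fix t
    have "1 + \<bar>1 / b * t\<bar> powr (2 * \<alpha>) = 1 + b powr (- (2 * \<alpha>)) * \<bar>t\<bar> powr (2 * \<alpha>)"
      using b by (simp add: abs_mult powr_divide powr_minus_divide)
    also have "\<dots> \<le> B + B * \<bar>t\<bar> powr (2 * \<alpha>)"
      using B by (intro add_mono mult_right_mono) auto
    finally have "exp (- t\<^sup>2) * (1 + \<bar>1 / b * t\<bar> powr (2 * \<alpha>)) \<le> exp (- t\<^sup>2) * (B + B * \<bar>t\<bar> powr (2 * \<alpha>))"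
      by (intro mult_left_mono) auto
    also have "\<dots> = B * (exp (- t\<^sup>2) * (1 + \<bar>t\<bar> powr (2 * \<alpha>)))"
      by (simp add: algebra_simps)
    finally show "ennreal (exp (- (b * (0 + 1 / b * t))\<^sup>2) * (1 + \<bar>0 + 1 / b * t\<bar> powr (2 * \<alpha>)))
        \<le> ennreal B * ennreal (exp (- t\<^sup>2) * (1 + \<bar>t\<bar> powr (2 * \<alpha>)))"
      using b B by (subst ennreal_mult[symmetric]) (auto intro!: ennreal_leI)
  qed simp
  also have "\<dots> = ennreal (1 / b) * (ennreal B * ennreal (gaussian_sobolev \<alpha>))"
    using b nn_integral_gaussian_powr_finite[OF \<alpha>]
    by (subst nn_integral_cmult) (auto simp: gaussian_sobolev_def)
  also have "\<dots> = ennreal (B / b * gaussian_sobolev \<alpha>)"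
    using b B gaussian_sobolev_nonneg[of \<alpha>] by (simp flip: ennreal_mult)
  finally show ?thesis .
qed

text \<open>The two terms are the wide component, with energy of order 1 / s, and the narrow
  Gaussians of total height \<eta> reaching frequency \<open>m\<close>, with energy of order
  \<eta>^2 m^(2\<alpha>+1). The factor 2 in the hypothesis on the transform leaves room for a
  renormalisation; squaring 2 (x + y) produces the 8.\<close>

lemma sobolev_classI:
  assumes \<alpha>: "0 < \<alpha>" and f: "prob_density f" and s: "1 \<le> s" and m: "1 \<le> m" and \<eta>: "0 \<le> \<eta>"
    and le: "\<And>t. cmod (fourier f t) \<le> 2 * (exp (- (s\<^sup>2 * t\<^sup>2 / 2)) + \<eta> * exp (- (t\<^sup>2 / m\<^sup>2)))"
    and K: "8 * gaussian_sobolev \<alpha> * (1 / s + \<eta>\<^sup>2 * m powr (2 * \<alpha> + 1)) \<le> K"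
  shows "f \<in> sobolev_class \<alpha> K"
proof -
  let ?w = "\<lambda>t::real. 1 + \<bar>t\<bar> powr (2 * \<alpha>)"
  have pt: "(cmod (fourier f t))\<^sup>2 \<le> 8 * exp (- (s * t)\<^sup>2) + 8 * \<eta>\<^sup>2 * exp (- (1 / m * t)\<^sup>2)" for t
  proof -
    define x where "x = exp (- (s\<^sup>2 * t\<^sup>2 / 2))"
    define y where "y = \<eta> * exp (- (t\<^sup>2 / m\<^sup>2))"
    have "(cmod (fourier f t))\<^sup>2 \<le> (2 * (x + y))\<^sup>2"
      using le[of t] by (intro power_mono) (auto simp: x_def y_def)
    also have "\<dots> \<le> 8 * x\<^sup>2 + 8 * y\<^sup>2"
      using sum_squares_bound[of x y] by (simp add: power2_eq_square algebra_simps)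
    also have "x\<^sup>2 = exp (- (s * t)\<^sup>2)"
      by (simp add: x_def power_mult_distrib flip: exp_double)
    also have "y\<^sup>2 \<le> \<eta>\<^sup>2 * exp (- (1 / m * t)\<^sup>2)"
    proof -
      have "y\<^sup>2 = \<eta>\<^sup>2 * exp (- (2 * (t\<^sup>2 / m\<^sup>2)))"
        by (simp add: y_def power_mult_distrib flip: exp_double)
      also have "\<dots> \<le> \<eta>\<^sup>2 * exp (- (1 / m * t)\<^sup>2)"
        by (intro mult_left_mono) (auto simp: power_mult_distrib power_divide intro!: divide_right_mono)
      finally show ?thesis .
    qed
    finally show ?thesis by simp
  qed
  have "(\<integral>\<^sup>+t. ennreal ((cmod (fourier f t))\<^sup>2 * ?w t) \<partial>lborel) \<le>
      (\<integral>\<^sup>+t. ennreal 8 * ennreal (exp (- (s * t)\<^sup>2) * ?w t) +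
        ennreal (8 * \<eta>\<^sup>2) * ennreal (exp (- (1 / m * t)\<^sup>2) * ?w t) \<partial>lborel)"
  proof (intro nn_integral_mono)
    fix t
    have "(cmod (fourier f t))\<^sup>2 * ?w t \<le> (8 * exp (- (s * t)\<^sup>2) + 8 * \<eta>\<^sup>2 * exp (- (1 / m * t)\<^sup>2)) * ?w t"
      by (intro mult_right_mono pt) (simp add: add_nonneg_nonneg)
    also have "\<dots> = 8 * (exp (- (s * t)\<^sup>2) * ?w t) + 8 * \<eta>\<^sup>2 * (exp (- (1 / m * t)\<^sup>2) * ?w t)"
      by (simp add: algebra_simps)
    finally have "ennreal ((cmod (fourier f t))\<^sup>2 * ?w t) \<le>
        ennreal (8 * (exp (- (s * t)\<^sup>2) * ?w t) + 8 * \<eta>\<^sup>2 * (exp (- (1 / m * t)\<^sup>2) * ?w t))"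
      by (rule ennreal_leI)
    also have "\<dots> = ennreal 8 * ennreal (exp (- (s * t)\<^sup>2) * ?w t) +
        ennreal (8 * \<eta>\<^sup>2) * ennreal (exp (- (1 / m * t)\<^sup>2) * ?w t)"
      by (intro ennreal_plus[THEN trans] arg_cong2[of _ _ _ _ "(+)"] ennreal_mult) auto
    finally show "ennreal ((cmod (fourier f t))\<^sup>2 * ?w t) \<le> ennreal 8 * ennreal (exp (- (s * t)\<^sup>2) * ?w t) +
        ennreal (8 * \<eta>\<^sup>2) * ennreal (exp (- (1 / m * t)\<^sup>2) * ?w t)" .
  qed
  also have "\<dots> = ennreal 8 * (\<integral>\<^sup>+t. ennreal (exp (- (s * t)\<^sup>2) * ?w t) \<partial>lborel) +
      ennreal (8 * \<eta>\<^sup>2) * (\<integral>\<^sup>+t. ennreal (exp (- (1 / m * t)\<^sup>2) * ?w t) \<partial>lborel)"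
    by (subst nn_integral_add) (auto simp: nn_integral_cmult)
  also have "\<dots> \<le> ennreal 8 * ennreal (1 / s * gaussian_sobolev \<alpha>) +
      ennreal (8 * \<eta>\<^sup>2) * ennreal (m powr (2 * \<alpha>) / (1 / m) * gaussian_sobolev \<alpha>)"
  proof (intro add_mono mult_left_mono nn_integral_gaussian_powr_scale_le \<alpha>)
    show "s powr (- (2 * \<alpha>)) \<le> 1"
      using s \<alpha> powr_mono[of "- (2 * \<alpha>)" 0 s] by simp
    show "1 \<le> m powr (2 * \<alpha>)"
      using m \<alpha> by (simp add: ge_one_powr_ge_zero)
    show "(1 / m) powr (- (2 * \<alpha>)) \<le> m powr (2 * \<alpha>)"
      using m by (simp add: powr_divide powr_minus_divide)
  qed (use s m in auto)
  also have "\<dots> = ennreal (8 * (1 / s * gaussian_sobolev \<alpha>) +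
      8 * \<eta>\<^sup>2 * (m powr (2 * \<alpha>) / (1 / m) * gaussian_sobolev \<alpha>))"
    using s m gaussian_sobolev_nonneg[of \<alpha>]
    by (intro sym[OF ennreal_plus[THEN trans]] arg_cong2[of _ _ _ _ "(+)"] ennreal_mult) auto
  also have "8 * (1 / s * gaussian_sobolev \<alpha>) + 8 * \<eta>\<^sup>2 * (m powr (2 * \<alpha>) / (1 / m) * gaussian_sobolev \<alpha>) =
      8 * gaussian_sobolev \<alpha> * (1 / s + \<eta>\<^sup>2 * m powr (2 * \<alpha> + 1))"
    using m by (simp add: powr_add algebra_simps)
  also have "\<dots> \<le> ennreal K"
    by (rule ennreal_leI[OF K])
  finally show ?thesis
    using f by (simp add: sobolev_class_def)
qed

text \<open>With standard deviation sqrt (2 j) / m, the j-th narrow Gaussian has transform E^j for E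
  = exp (- t^2 / m^2), so the contamination becomes a polynomial in E without constant term.\<close>

definition contaminated :: "real \<Rightarrow> real \<Rightarrow> nat \<Rightarrow> real \<Rightarrow> (nat \<Rightarrow> real) \<Rightarrow> real \<Rightarrow> real" where
  "contaminated s m r \<delta> w x =
     (1 - 2 ^ r * \<delta>) * heavy_density s x + \<delta> * (\<Sum>j=1..r. w j * normal_density 0 (sqrt (2 * real j) / m) x)"

section \<open>Mass, lower bound and transform of a contaminated mixture\<close>

context
  fixes s m \<delta> :: real and r :: nat and w :: "nat \<Rightarrow> real"
  assumes s: "1 \<le> s" and m: "1 \<le> m" and \<delta>: "0 \<le> \<delta>" "2 ^ r * \<delta> \<le> 1 / 2" and w: "\<And>j. 0 \<le> w j"
begin

lemma contaminated_scale_pos: "j \<in> {1..r} \<Longrightarrow> 0 < sqrt (2 * real j) / m"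
  using m by auto

lemma contaminated_sum_integrable:
  "integrable lborel (\<lambda>x. \<Sum>j=1..r. w j * normal_density 0 (sqrt (2 * real j) / m) x)"
  using contaminated_scale_pos
  by (intro Bochner_Integration.integrable_sum integrable_mult_right integrable_normal_density) auto

lemma contaminated_integrable: "integrable lborel (contaminated s m r \<delta> w)"
  unfolding contaminated_def
  by (intro Bochner_Integration.integrable_add integrable_mult_right heavy_density_integrable[OF s]
      contaminated_sum_integrable)

lemma contaminated_integral:
  "(\<integral>x. contaminated s m r \<delta> w x \<partial>lborel) = (1 - 2 ^ r * \<delta>) + \<delta> * (\<Sum>j=1..r. w j)"
proof -
  have "(\<integral>x. (\<Sum>j=1..r. w j * normal_density 0 (sqrt (2 * real j) / m) x) \<partial>lborel) =
      (\<Sum>j=1..r. \<integral>x. w j * normal_density 0 (sqrt (2 * real j) / m) x \<partial>lborel)"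
    using contaminated_scale_pos
    by (intro Bochner_Integration.integral_sum integrable_mult_right integrable_normal_density) auto
  also have "\<dots> = (\<Sum>j=1..r. w j)"
    using contaminated_scale_pos by (intro sum.cong) auto
  finally have sum: "(\<integral>x. (\<Sum>j=1..r. w j * normal_density 0 (sqrt (2 * real j) / m) x) \<partial>lborel) = (\<Sum>j=1..r. w j)" .
  have "(\<integral>x. contaminated s m r \<delta> w x \<partial>lborel) = (\<integral>x. (1 - 2 ^ r * \<delta>) * heavy_density s x \<partial>lborel) +
      (\<integral>x. \<delta> * (\<Sum>j=1..r. w j * normal_density 0 (sqrt (2 * real j) / m) x) \<partial>lborel)"
    unfolding contaminated_def
    by (intro Bochner_Integration.integral_add integrable_mult_right heavy_density_integrable[OF s]
        contaminated_sum_integrable)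
  then show ?thesis
    by (simp add: heavy_density_integral[OF s] sum del: One_nat_def)
qed

text \<open>2^r \<delta> \<le> 1/2 leaves at least half of the heavy component, and the non-negative
  weights can only add to it.\<close>

lemma contaminated_ge: "heavy_density s x / 2 \<le> contaminated s m r \<delta> w x"
proof -
  have "1 / 2 * heavy_density s x \<le> (1 - 2 ^ r * \<delta>) * heavy_density s x"
    using \<delta> heavy_density_nonneg[OF s] by (intro mult_right_mono) auto
  moreover have "0 \<le> \<delta> * (\<Sum>j=1..r. w j * normal_density 0 (sqrt (2 * real j) / m) x)"
    using \<delta> w by (intro mult_nonneg_nonneg sum_nonneg) auto
  ultimately show ?thesis
    by (simp add: contaminated_def)
qed

text \<open>The bound depends on \<open>m\<close> and \<delta>; only its existence matters, to make
  the convolution with the noise finite at every point.\<close>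

lemma contaminated_bounded: "\<exists>B. \<forall>x. contaminated s m r \<delta> w x \<le> B"
proof (intro exI allI)
  fix x
  have "(1 - 2 ^ r * \<delta>) * heavy_density s x \<le> 1 * 1"
    using \<delta> heavy_density_nonneg[OF s] heavy_density_le_1[OF s] by (intro mult_mono) auto
  moreover have "(\<Sum>j=1..r. w j * normal_density 0 (sqrt (2 * real j) / m) x) \<le> (\<Sum>j=1..r. w j * (1 / (sqrt (2 * real j) / m)))"
    using w contaminated_scale_pos by (intro sum_mono mult_left_mono normal_density_le) auto
  ultimately show "contaminated s m r \<delta> w x \<le> 1 + \<delta> * (\<Sum>j=1..r. w j * (1 / (sqrt (2 * real j) / m)))"
    unfolding contaminated_def using \<delta>(1) by (intro add_mono mult_left_mono) auto
qed

lemma fourier_contaminated: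
  "fourier (contaminated s m r \<delta> w) t =
    (1 - 2 ^ r * \<delta>) * fourier (heavy_density s) t + \<delta> * (\<Sum>j=1..r. w j * exp (- (t\<^sup>2 / m\<^sup>2)) ^ j)"
proof -
  have "fourier (contaminated s m r \<delta> w) t = (1 - 2 ^ r * \<delta>) * fourier (heavy_density s) t +
      \<delta> * fourier (\<lambda>x. \<Sum>j=1..r. w j * normal_density 0 (sqrt (2 * real j) / m) x) t"
    unfolding contaminated_def
    by (rule fourier_lincomb[OF heavy_density_integrable[OF s] contaminated_sum_integrable])
  also have "fourier (\<lambda>x. \<Sum>j=1..r. w j * normal_density 0 (sqrt (2 * real j) / m) x) t =
      (\<Sum>j=1..r. w j * fourier (normal_density 0 (sqrt (2 * real j) / m)) t)"
    using contaminated_scale_pos by (intro fourier_sum integrable_normal_density) auto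
  also have "\<dots> = (\<Sum>j=1..r. complex_of_real (w j * exp (- (t\<^sup>2 / m\<^sup>2)) ^ j))"
  proof (intro sum.cong refl)
    fix j assume "j \<in> {1..r}"
    then show "complex_of_real (w j) * fourier (normal_density 0 (sqrt (2 * real j) / m)) t =
        complex_of_real (w j * exp (- (t\<^sup>2 / m\<^sup>2)) ^ j)"
      unfolding fourier_normal_density[OF contaminated_scale_pos[OF \<open>j \<in> {1..r}\<close>]]
      by (simp add: power_divide mult_ac flip: exp_of_nat_mult)
  qed
  finally show ?thesis by simp
qed

lemma norm_fourier_contaminated_le:
  assumes W: "(\<Sum>j=1..r. w j) \<le> 2 ^ r"
  shows "cmod (fourier (contaminated s m r \<delta> w) t) \<le> exp (- (s\<^sup>2 * t\<^sup>2 / 2)) + (2 ^ r * \<delta>) * exp (- (t\<^sup>2 / m\<^sup>2))"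
proof -
  let ?E = "exp (- (t\<^sup>2 / m\<^sup>2))"
  have "cmod (fourier (contaminated s m r \<delta> w) t) \<le>
      cmod (complex_of_real (1 - 2 ^ r * \<delta>) * fourier (heavy_density s) t) +
      cmod (complex_of_real (\<delta> * (\<Sum>j=1..r. w j * ?E ^ j)))"
    unfolding fourier_contaminated by (rule norm_triangle_ineq[THEN order_trans]) simp
  also have "cmod (complex_of_real (1 - 2 ^ r * \<delta>) * fourier (heavy_density s) t) \<le> 1 * exp (- (s\<^sup>2 * t\<^sup>2 / 2))"
    unfolding norm_mult norm_of_real using \<delta>
    by (intro mult_mono norm_fourier_heavy_density_le[OF s]) auto
  also have "cmod (complex_of_real (\<delta> * (\<Sum>j=1..r. w j * ?E ^ j))) = \<delta> * (\<Sum>j=1..r. w j * ?E ^ j)"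
    using \<delta> w by (simp add: abs_mult sum_nonneg abs_of_nonneg del: of_real_mult of_real_sum)
  also have "\<dots> \<le> \<delta> * (2 ^ r * ?E)"
  proof (rule mult_left_mono[OF _ \<delta>(1)])
    \<comment> \<open>The sum starts at j = 1: a term j = 0 would be a point mass at 0, whose
      transform does not decay.\<close>
    have "?E ^ j \<le> ?E" if "j \<in> {1..r}" for j
      using that power_decreasing[of 1 j ?E] by simp
    then have "(\<Sum>j=1..r. w j * ?E ^ j) \<le> (\<Sum>j=1..r. w j * ?E)"
      using w by (intro sum_mono mult_left_mono) auto
    also have "\<dots> = (\<Sum>j=1..r. w j) * ?E"
      by (simp add: sum_distrib_right)
    also have "\<dots> \<le> 2 ^ r * ?E"
      using W by (intro mult_right_mono) auto
    finally show "(\<Sum>j=1..r. w j * ?E ^ j) \<le> 2 ^ r * ?E" .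
  qed
  finally show ?thesis
    by (simp add: mult_ac)
qed

end

text \<open>The inequality 1 + (x - y)^2 \<le> 2 (1 + x^2) (1 + y^2) separates x from y, so
  convolution keeps a lower bound of order 1 / (1 + x^2), whatever the tails of the noise; these
  affect only the constant.\<close>

lemma obs_density_ge:
  assumes k: "prob_density k" and f: "prob_density f" and B: "\<And>x. f x \<le> B" and c: "0 \<le> c"
    and low: "\<And>x. c / (1 + x\<^sup>2) \<le> f x"
  shows "(c / 2 * (\<integral>y. k y / (1 + y\<^sup>2) \<partial>lborel)) / (1 + x\<^sup>2) \<le> obs_density k 0 f x"
proof -
  have f': "f \<in> borel_measurable borel" "\<And>x. 0 \<le> f x" and k': "k \<in> borel_measurable borel" "\<And>x. 0 \<le> k x"
    using k f by (auto simp: prob_density_def)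
  note [measurable] = f'(1) k'(1)
  have pos: "0 < 1 + y\<^sup>2" for y :: real
    by (simp add: add_pos_nonneg)
  have "(c / 2 * (\<integral>y. k y / (1 + y\<^sup>2) \<partial>lborel)) / (1 + x\<^sup>2) =
      (\<integral>y. c / (2 * ((1 + x\<^sup>2) * (1 + y\<^sup>2))) * k y \<partial>lborel)"
    by (simp add: field_simps flip: integral_mult_right_zero integral_divide_zero)
  also have "\<dots> \<le> (\<integral>y. f (x - y) * k y \<partial>lborel)"
  proof (rule integral_mono')
    show "integrable lborel (\<lambda>y. f (x - y) * k y)"
    proof (rule Bochner_Integration.integrable_bound)
      show "integrable lborel (\<lambda>y. B * k y)"
        using prob_density_integrable[OF k] by simp
      show "AE y in lborel. norm (f (x - y) * k y) \<le> norm (B * k y)"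
        using f'(2) k'(2) order_trans[OF B abs_ge_self]
        by (intro AE_I2) (auto simp: abs_mult intro!: mult_right_mono)
    qed simp
    fix y
    have "1 + (x - y)\<^sup>2 \<le> 1 + 2 * x\<^sup>2 + 2 * y\<^sup>2"
      using sum_squares_bound[of x "- y"] by (simp add: power2_diff)
    also have "\<dots> \<le> 2 * ((1 + x\<^sup>2) * (1 + y\<^sup>2))"
      by (simp add: algebra_simps)
    finally have "c / (2 * ((1 + x\<^sup>2) * (1 + y\<^sup>2))) \<le> c / (1 + (x - y)\<^sup>2)"
      using c pos by (intro divide_left_mono mult_pos_pos) auto
    also have "\<dots> \<le> f (x - y)"
      by (rule low)
    finally show "c / (2 * ((1 + x\<^sup>2) * (1 + y\<^sup>2))) * k y \<le> f (x - y) * k y"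
      using k'(2) by (rule mult_right_mono)
    show "0 \<le> f (x - y) * k y"
      using f'(2) k'(2) by simp
  qed
  finally show ?thesis
    by (simp add: obs_density_def)
qed

lemma integral_density_weight_pos:
  assumes k: "prob_density k"
  shows "0 < (\<integral>y. k y / (1 + y\<^sup>2) \<partial>lborel)"
proof -
  have k': "k \<in> borel_measurable borel" "\<And>x. 0 \<le> k x"
    using k by (auto simp: prob_density_def)
  note [measurable] = k'(1)
  have pos: "0 < 1 + y\<^sup>2" for y :: real
    by (simp add: add_pos_nonneg)
  have int: "integrable lborel (\<lambda>y. k y / (1 + y\<^sup>2))"
  proof (rule Bochner_Integration.integrable_bound[OF prob_density_integrable(1)[OF k]])
    show "AE y in lborel. norm (k y / (1 + y\<^sup>2)) \<le> norm (k y)"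
      using k'(2) divide_left_mono[of 1 "1 + y\<^sup>2" "k y" for y]
      by (intro AE_I2) (auto simp: abs_of_nonneg pos)
  qed simp
  have "(\<integral>y. k y / (1 + y\<^sup>2) \<partial>lborel) \<noteq> 0"
  proof
    assume "(\<integral>y. k y / (1 + y\<^sup>2) \<partial>lborel) = 0"
    then have "AE y in lborel. k y / (1 + y\<^sup>2) = 0"
      using k'(2) by (subst (asm) integral_nonneg_eq_0_iff_AE[OF int]) (auto simp: less_imp_le[OF pos])
    then have "AE y in lborel. k y = 0"
      by eventually_elim (use pos in \<open>auto simp: less_imp_neq[symmetric]\<close>)
    then have "(\<integral>y. k y \<partial>lborel) = (\<integral>y. 0 \<partial>(lborel :: real measure))"
      by (intro integral_cong_AE) auto
    then show False
      using prob_density_integrable(2)[OF k] by simp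
  qed
  moreover have "0 \<le> (\<integral>y. k y / (1 + y\<^sup>2) \<partial>lborel)"
    using k'(2) by (intro integral_nonneg_AE AE_I2) (simp add: less_imp_le[OF pos])
  ultimately show ?thesis by simp
qed

section \<open>The high-pass factor\<close>

text \<open>The common frequency profile, in units of the cutoff, of the filtered noise transform
  and of its difference quotients: flat up to the cutoff, then decaying like the noise.\<close>

definition envelope :: "real \<Rightarrow> real \<Rightarrow> real" where
  "envelope \<beta> u = (if \<bar>u\<bar> \<le> 1 then 1 else \<bar>u\<bar> powr (- \<beta>))"

lemma envelope_nonneg: "0 \<le> envelope \<beta> u"
  by (simp add: envelope_def)

lemma envelope_measurable [measurable]: "envelope \<beta> \<in> borel_measurable borel"
  unfolding envelope_def by measurable

text \<open>Slow variation, which absorbs the unknown intermediate point of the mean value theorem.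
  For |u| \<le> 2 the factor 2^\<beta> brings the envelope back to 1; beyond, a shift by 1 at most
  halves |u|.\<close>

lemma envelope_shift:
  assumes \<beta>: "0 < \<beta>" and v: "\<bar>v\<bar> \<le> 1"
  shows "envelope \<beta> (u + v) \<le> 2 powr \<beta> * envelope \<beta> u"
proof (cases "\<bar>u\<bar> \<le> 2")
  case True
  have "envelope \<beta> (u + v) \<le> 1"
    using \<beta> powr_mono[of "- \<beta>" 0 "\<bar>u + v\<bar>"] by (auto simp: envelope_def split: if_splits)
  also have "1 \<le> 2 powr \<beta> * envelope \<beta> u"
  proof (cases "\<bar>u\<bar> \<le> 1")
    case True
    then show ?thesis
      using \<beta> by (simp add: envelope_def ge_one_powr_ge_zero)
  next
    case False
    then have "2 powr (- \<beta>) \<le> \<bar>u\<bar> powr (- \<beta>)"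
      using \<open>\<bar>u\<bar> \<le> 2\<close> \<beta> by (intro powr_mono2') auto
    then have "2 powr \<beta> * 2 powr (- \<beta>) \<le> 2 powr \<beta> * \<bar>u\<bar> powr (- \<beta>)"
      by (intro mult_left_mono) auto
    then show ?thesis
      using False by (simp add: envelope_def flip: powr_add)
  qed
  finally show ?thesis .
next
  case False
  have "\<bar>u\<bar> / 2 \<le> \<bar>u + v\<bar>"
    using False v by linarith
  then have "\<bar>u + v\<bar> powr (- \<beta>) \<le> (\<bar>u\<bar> / 2) powr (- \<beta>)"
    using False \<beta> by (intro powr_mono2') auto
  also have "\<dots> = 2 powr \<beta> * \<bar>u\<bar> powr (- \<beta>)"
    by (simp add: powr_divide powr_minus_divide)
  finally show ?thesis
    using False v by (auto simp: envelope_def)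
qed

text \<open>The squared tail u^(-2\<beta>) is integrable exactly because \<beta> > 1/2.\<close>

lemma nn_integral_envelope_finite:
  assumes \<beta>: "1 / 2 < \<beta>"
  shows "(\<integral>\<^sup>+u. ennreal ((envelope \<beta> u)\<^sup>2) \<partial>lborel) < \<infinity>"
proof -
  let ?h = "\<lambda>u::real. ennreal (u powr (- 2 * \<beta>)) * indicator {1..} u"
  have tail: "(\<integral>\<^sup>+u. ?h u \<partial>lborel) = ennreal (0 - (- (1 powr (1 - 2 * \<beta>) / (2 * \<beta> - 1))))"
  proof (rule nn_integral_FTC_atLeast[where F = "\<lambda>u. - (u powr (1 - 2 * \<beta>) / (2 * \<beta> - 1))"])
    show "((\<lambda>u. - (u powr (1 - 2 * \<beta>) / (2 * \<beta> - 1))) has_real_derivative u powr (- 2 * \<beta>)) (at u)"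
      if "1 \<le> u" for u
    proof -
      have "((\<lambda>u. - (u powr (1 - 2 * \<beta>) / (2 * \<beta> - 1))) has_real_derivative
          - ((1 - 2 * \<beta>) * u powr (1 - 2 * \<beta> - 1) / (2 * \<beta> - 1))) (at u)"
        using that by (intro DERIV_minus DERIV_cdivide has_real_derivative_powr) auto
      moreover have "- ((1 - 2 * \<beta>) * y / (2 * \<beta> - 1)) = y" for y
        using \<beta> by (simp add: field_simps)
      ultimately show ?thesis
        by simp
    qed
    have "((\<lambda>u::real. u powr (1 - 2 * \<beta>)) \<longlongrightarrow> 0) at_top"
      using \<beta> by (intro tendsto_neg_powr filterlim_ident) auto
    then have "((\<lambda>u::real. - (u powr (1 - 2 * \<beta>) / (2 * \<beta> - 1))) \<longlongrightarrow> - (0 / (2 * \<beta> - 1))) at_top"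
      using \<beta> by (intro tendsto_intros) auto
    then show "((\<lambda>u::real. - (u powr (1 - 2 * \<beta>) / (2 * \<beta> - 1))) \<longlongrightarrow> 0) at_top"
      by simp
  qed auto
  have mirror: "(\<integral>\<^sup>+u. ?h (- u) \<partial>lborel) = (\<integral>\<^sup>+u. ?h u \<partial>lborel)"
    using nn_integral_real_affine[of ?h "-1" 0] by simp
  have "(\<integral>\<^sup>+u. ennreal ((envelope \<beta> u)\<^sup>2) \<partial>lborel) \<le>
      (\<integral>\<^sup>+u. indicator {-1..1::real} u + (?h u + ?h (- u)) \<partial>lborel)"
  proof (intro nn_integral_mono)
    fix u :: real
    have "(\<bar>u\<bar> powr (- \<beta>))\<^sup>2 = \<bar>u\<bar> powr (- 2 * \<beta>)"
      by (simp add: power2_eq_square flip: powr_add)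
    then show "ennreal ((envelope \<beta> u)\<^sup>2) \<le> indicator {-1..1} u + (?h u + ?h (- u))"
      by (auto simp: envelope_def indicator_def abs_if)
  qed
  also have "\<dots> = (\<integral>\<^sup>+u. indicator {-1..1::real} u \<partial>lborel) + ((\<integral>\<^sup>+u. ?h u \<partial>lborel) + (\<integral>\<^sup>+u. ?h (- u) \<partial>lborel))"
    by (simp add: nn_integral_add)
  also have "\<dots> < \<infinity>"
    unfolding mirror tail by simp
  finally show ?thesis .
qed

definition envelope_mass :: "real \<Rightarrow> real" where
  "envelope_mass \<beta> = enn2real (\<integral>\<^sup>+u. ennreal ((envelope \<beta> u)\<^sup>2) \<partial>lborel)"

lemma envelope_mass_nonneg: "0 \<le> envelope_mass \<beta>"
  by (simp add: envelope_mass_def)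

text \<open>The substitution t = m u produces the factor \<open>m\<close>, the width of the
  frequency band.\<close>

lemma nn_integral_envelope_le:
  fixes g :: "real \<Rightarrow> real"
  assumes \<beta>: "1 / 2 < \<beta>" and m: "0 < m" and g0: "\<And>t. 0 \<le> g t" and g: "\<And>t. g t \<le> a * envelope \<beta> (t / m)"
  shows "(\<integral>\<^sup>+t. ennreal ((g t)\<^sup>2) \<partial>lborel) \<le> ennreal (a\<^sup>2 * m * envelope_mass \<beta>)"
proof -
  have "(\<integral>\<^sup>+t. ennreal ((g t)\<^sup>2) \<partial>lborel) \<le> (\<integral>\<^sup>+t. ennreal (a\<^sup>2) * ennreal ((envelope \<beta> (t / m))\<^sup>2) \<partial>lborel)"
    using power_mono[OF g g0, of _ 2]
    by (intro nn_integral_mono) (simp add: power_mult_distrib ennreal_leI flip: ennreal_mult)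
  also have "\<dots> = ennreal (a\<^sup>2) * (\<integral>\<^sup>+t. ennreal ((envelope \<beta> (t / m))\<^sup>2) \<partial>lborel)"
    by (rule nn_integral_cmult) simp
  also have "(\<integral>\<^sup>+t. ennreal ((envelope \<beta> (t / m))\<^sup>2) \<partial>lborel) =
      \<bar>m\<bar> * (\<integral>\<^sup>+u. ennreal ((envelope \<beta> ((0 + m * u) / m))\<^sup>2) \<partial>lborel)"
    using m by (intro nn_integral_real_affine) auto
  also have "\<dots> = ennreal m * ennreal (envelope_mass \<beta>)"
    using m nn_integral_envelope_finite[OF \<beta>] by (simp add: envelope_mass_def)
  also have "ennreal (a\<^sup>2) * (ennreal m * ennreal (envelope_mass \<beta>)) = ennreal (a\<^sup>2 * m * envelope_mass \<beta>)"
    using m by (simp add: envelope_mass_nonneg mult.assoc flip: ennreal_mult)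
  finally show ?thesis .
qed

lemma one_minus_gauss_bounds:
  fixes u :: real
  shows "0 \<le> 1 - exp (- u\<^sup>2)" "1 - exp (- u\<^sup>2) \<le> 1" "1 - exp (- u\<^sup>2) \<le> u\<^sup>2"
  using exp_ge_add_one_self[of "- u\<^sup>2"] by auto

text \<open>Below the cutoff the filter is at most |t / m|^(2q) \<le> |t / m|^\<beta>, which
  compensates the missing decay of the noise; above it the filter is at most 1 and the noise has
  decayed. Both regimes gain the same m^(-\<beta>).\<close>

lemma high_pass_le_envelope:
  fixes t m \<beta> :: real
  assumes \<beta>: "0 < \<beta>" "\<beta> \<le> 2 * real q" and m: "0 < m"
  shows "(1 - exp (- (t / m)\<^sup>2)) ^ q / (1 + \<bar>t\<bar> powr \<beta>) \<le> m powr (- \<beta>) * envelope \<beta> (t / m)"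
proof -
  have pos: "0 < 1 + \<bar>t\<bar> powr \<beta>"
    by (simp add: add_pos_nonneg)
  have "0 < q"
    using \<beta> by (intro Nat.gr0I) auto
  show ?thesis
  proof (cases "\<bar>t / m\<bar> \<le> 1")
    case True
    have "(1 - exp (- (t / m)\<^sup>2)) ^ q \<le> ((t / m)\<^sup>2) ^ q"
      by (intro power_mono one_minus_gauss_bounds)
    also have "\<dots> \<le> \<bar>t / m\<bar> powr \<beta>"
    proof (cases "t = 0")
      case True
      then show ?thesis using \<open>0 < q\<close> by (simp add: zero_power)
    next
      case False
      then have "((t / m)\<^sup>2) ^ q = \<bar>t / m\<bar> powr (2 * real q)"
        using m powr_realpow[of "\<bar>t / m\<bar>" "2 * q"] by (simp add: power_mult power_divide)
      also have "\<dots> \<le> \<bar>t / m\<bar> powr \<beta>"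
        using True \<beta> by (intro powr_mono') auto
      finally show ?thesis .
    qed
    also have "\<dots> = m powr (- \<beta>) * \<bar>t\<bar> powr \<beta>"
      using m by (simp add: powr_divide powr_minus_divide)
    also have "\<dots> \<le> m powr (- \<beta>) * (1 + \<bar>t\<bar> powr \<beta>)"
      by (intro mult_left_mono) auto
    finally show ?thesis
      using True pos by (simp add: envelope_def pos_divide_le_eq)
  next
    case False
    then have "t \<noteq> 0" by auto
    have "(1 - exp (- (t / m)\<^sup>2)) ^ q / (1 + \<bar>t\<bar> powr \<beta>) \<le> 1 / (1 + \<bar>t\<bar> powr \<beta>)"
      using pos one_minus_gauss_bounds[of "t / m"] by (intro divide_right_mono power_le_one) auto
    also have "\<dots> \<le> 1 / \<bar>t\<bar> powr \<beta>"
      using \<open>t \<noteq> 0\<close> pos by (intro divide_left_mono) auto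
    also have "\<dots> = m powr (- \<beta>) * envelope \<beta> (t / m)"
      using False m \<open>t \<noteq> 0\<close> by (simp add: envelope_def powr_divide powr_minus_divide)
    finally show ?thesis .
  qed
qed

text \<open>The exponent is \<open>Suc q\<close> because differentiating the filter costs one
  factor, and \<open>q\<close> factors must remain for the envelope. In 2q + 3, the 1 comes from the
  derivative of \<phi> and 2 (q + 1) from that of the filter, whose base has derivative at most 2;
  2^\<beta> comes from shifting the envelope.\<close>

lemma high_pass_bounds:
  fixes \<phi> \<phi>' :: "real \<Rightarrow> complex" and m \<beta> d :: real
  assumes \<beta>: "0 < \<beta>" "\<beta> \<le> 2 * real q" and m: "1 \<le> m" and d: "0 < d"
    and \<phi>: "\<And>t. cmod (\<phi> t) \<le> d / (1 + \<bar>t\<bar> powr \<beta>)"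
    and \<phi>': "\<And>t. (\<phi> has_vector_derivative \<phi>' t) (at t)" "\<And>t. cmod (\<phi>' t) \<le> d / (1 + \<bar>t\<bar> powr \<beta>)"
  defines "\<psi> \<equiv> \<lambda>t. complex_of_real ((1 - exp (- (t / m)\<^sup>2)) ^ Suc q) * \<phi> t"
    and "a \<equiv> (2 * real q + 3) * d * 2 powr \<beta> * m powr (- \<beta>)"
  shows "cmod (\<psi> t) \<le> a * envelope \<beta> (t / m)"
    and "0 < h \<Longrightarrow> h \<le> 1 \<Longrightarrow> cmod (\<psi> (t + h) - \<psi> (t - h)) / (2 * h) \<le> a * envelope \<beta> (t / m)"
proof -
  define e where "e t = 1 - exp (- (t / m)\<^sup>2)" for t
  have e: "0 \<le> e t" "e t \<le> 1" for t
    using one_minus_gauss_bounds[of "t / m"] by (auto simp: e_def)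
  have pos: "0 < 1 + \<bar>t\<bar> powr \<beta>" for t
    by (simp add: add_pos_nonneg)
  let ?g = "\<lambda>t. d * (e t ^ q / (1 + \<bar>t\<bar> powr \<beta>))"
  have g: "?g t \<le> d * (m powr (- \<beta>) * envelope \<beta> (t / m))" for t
    unfolding e_def using m d by (intro mult_left_mono high_pass_le_envelope \<beta>) auto
  have "1 \<le> 2 powr \<beta>"
    using \<beta> by (simp add: ge_one_powr_ge_zero)
  have bnd: "cmod (complex_of_real (e t ^ Suc q) * z) \<le> ?g t" if "cmod z \<le> d / (1 + \<bar>t\<bar> powr \<beta>)" for t z
  proof -
    have "e t ^ Suc q \<le> e t ^ q"
      using e by (intro power_decreasing) auto
    then have "e t ^ Suc q * cmod z \<le> e t ^ q * (d / (1 + \<bar>t\<bar> powr \<beta>))"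
      using that e by (intro mult_mono) auto
    then show ?thesis
      using e by (simp add: norm_mult norm_power mult_ac)
  qed
  show "cmod (\<psi> t) \<le> a * envelope \<beta> (t / m)"
  proof -
    have "cmod (\<psi> t) \<le> d * (m powr (- \<beta>) * envelope \<beta> (t / m))"
      unfolding \<psi>_def e_def[symmetric] by (rule order_trans[OF bnd[OF \<phi>] g])
    also have "\<dots> = 1 * (d * (m powr (- \<beta>) * envelope \<beta> (t / m)))"
      by simp
    also have "\<dots> \<le> ((2 * real q + 3) * 2 powr \<beta>) * (d * (m powr (- \<beta>) * envelope \<beta> (t / m)))"
      using d \<open>1 \<le> 2 powr \<beta>\<close> mult_mono[of 1 "2 * real q + 3" 1 "2 powr \<beta>"]
      by (intro mult_right_mono mult_nonneg_nonneg envelope_nonneg) auto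
    finally show ?thesis
      by (simp add: a_def mult_ac)
  qed
  define \<psi>' where "\<psi>' t = complex_of_real (e t ^ Suc q) * \<phi>' t +
      complex_of_real (real (Suc q) * e t ^ q * (2 * (t / m) / m * exp (- (t / m)\<^sup>2))) * \<phi> t" for t
  have deriv: "(\<psi> has_vector_derivative \<psi>' t) (at t)" for t
  proof -
    have "((\<lambda>t. 1 - exp (- (t / m)\<^sup>2)) has_real_derivative 2 * (t / m) / m * exp (- (t / m)\<^sup>2)) (at t)"
      using m by (auto intro!: derivative_eq_intros simp: power2_eq_square)
    from DERIV_power[OF this, of "Suc q"]
    have "((\<lambda>t. (1 - exp (- (t / m)\<^sup>2)) ^ Suc q) has_real_derivative
        (real (Suc q) * e t ^ q * (2 * (t / m) / m * exp (- (t / m)\<^sup>2)))) (at t)"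
      unfolding e_def
      by (simp add: mult_ac)
    then have "((\<lambda>t. complex_of_real ((1 - exp (- (t / m)\<^sup>2)) ^ Suc q)) has_vector_derivative
        complex_of_real (real (Suc q) * e t ^ q * (2 * (t / m) / m * exp (- (t / m)\<^sup>2)))) (at t)"
      by (rule has_vector_derivative_of_real)
    from has_vector_derivative_mult[OF this \<phi>'(1)] show ?thesis
      by (simp only: \<psi>_def \<psi>'_def e_def)
  qed
  have \<psi>'_le: "cmod (\<psi>' t) \<le> (2 * real q + 3) * ?g t" for t
  proof -
    define b where "b = 2 * (t / m) / m * exp (- (t / m)\<^sup>2)"
    have b: "\<bar>b\<bar> \<le> 2"
    proof -
      have "\<bar>t / m\<bar> \<le> 1 + (t / m)\<^sup>2"
        using sum_squares_bound[of "\<bar>t / m\<bar>" 1] unfolding power2_abs power_one by linarith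
      also have "\<dots> \<le> exp ((t / m)\<^sup>2)"
        by (rule exp_ge_add_one_self)
      finally have "\<bar>t / m\<bar> * exp (- (t / m)\<^sup>2) \<le> exp ((t / m)\<^sup>2) * exp (- (t / m)\<^sup>2)"
        by (intro mult_right_mono) auto
      then have "\<bar>t / m\<bar> * exp (- (t / m)\<^sup>2) \<le> 1"
        by (simp flip: exp_add)
      then have "2 / m * (\<bar>t / m\<bar> * exp (- (t / m)\<^sup>2)) \<le> 2 * 1"
        using m by (intro mult_mono) (auto simp: divide_le_eq)
      then show ?thesis
        using m by (simp add: b_def abs_mult)
    qed
    have "cmod (complex_of_real (real (Suc q) * e t ^ q * b) * \<phi> t) = real (Suc q) * \<bar>b\<bar> * (e t ^ q * cmod (\<phi> t))"
      using e by (simp add: norm_mult norm_power abs_mult del: of_nat_Suc)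
    also have "\<dots> \<le> real (Suc q) * 2 * (e t ^ q * (d / (1 + \<bar>t\<bar> powr \<beta>)))"
      using b \<phi>[of t] e by (intro mult_mono) auto
    also have "\<dots> = (2 * real q + 2) * ?g t"
      by (simp add: algebra_simps)
    finally have "cmod (complex_of_real (real (Suc q) * e t ^ q * b) * \<phi> t) \<le> (2 * real q + 2) * ?g t" .
    moreover have "cmod (\<psi>' t) \<le> cmod (complex_of_real (e t ^ Suc q) * \<phi>' t) +
        cmod (complex_of_real (real (Suc q) * e t ^ q * b) * \<phi> t)"
      unfolding \<psi>'_def b_def by (rule norm_triangle_ineq)
    ultimately have "cmod (\<psi>' t) \<le> ?g t + (2 * real q + 2) * ?g t"
      using bnd[OF \<phi>'(2)[of t]] by linarith
    also have "\<dots> = (2 * real q + 3) * ?g t"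
      by (simp only: distrib_right) simp
    finally show ?thesis .
  qed
  assume h: "0 < h" "h \<le> 1"
  \<comment> \<open>For complex values the mean value theorem is an inequality. The intermediate
    point lies within 1 of \<open>t\<close>, and m \<ge> 1 keeps the rescaled distance below
    1.\<close>
  have "\<exists>x\<in>{t - h<..<t + h}. norm (\<psi> (t + h) - \<psi> (t - h)) \<le> norm (((t + h) - (t - h)) *\<^sub>R \<psi>' x)"
  proof (rule mvt_general)
    show "t - h < t + h"
      using h by simp
    show "continuous_on {t - h..t + h} \<psi>"
      using deriv by (intro continuous_at_imp_continuous_on ballI has_vector_derivative_continuous)
    show "(\<psi> has_derivative (\<lambda>y. y *\<^sub>R \<psi>' x)) (at x)" for x
      using deriv[of x] by (simp add: has_vector_derivative_def)
  qed
  then obtain x where x: "t - h < x" "x < t + h" "norm (\<psi> (t + h) - \<psi> (t - h)) \<le> 2 * h * norm (\<psi>' x)"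
    using h by auto
  have "norm (\<psi>' x) \<le> (2 * real q + 3) * (d * (m powr (- \<beta>) * envelope \<beta> (x / m)))"
    by (rule order_trans[OF \<psi>'_le]) (intro mult_left_mono g; simp)
  also have "envelope \<beta> (x / m) \<le> 2 powr \<beta> * envelope \<beta> (t / m)"
  proof -
    have "\<bar>x - t\<bar> \<le> 1"
      using x h by linarith
    then have "\<bar>(x - t) / m\<bar> \<le> 1"
      using m by (simp add: divide_le_eq)
    from envelope_shift[OF \<beta>(1) this, of "t / m"] show ?thesis
      by (simp add: diff_divide_distrib)
  qed
  finally have "norm (\<psi>' x) \<le> (2 * real q + 3) * (d * (m powr (- \<beta>) * (2 powr \<beta> * envelope \<beta> (t / m))))"
    using d by (simp add: mult_left_mono)
  also have "\<dots> = a * envelope \<beta> (t / m)"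
    by (simp add: a_def mult_ac)
  finally have "2 * h * norm (\<psi>' x) \<le> 2 * h * (a * envelope \<beta> (t / m))"
    using h by (intro mult_left_mono) auto
  with x(3) have "cmod (\<psi> (t + h) - \<psi> (t - h)) \<le> (a * envelope \<beta> (t / m)) * (2 * h)"
    by (simp only: mult.commute order_trans)
  then show "cmod (\<psi> (t + h) - \<psi> (t - h)) / (2 * h) \<le> a * envelope \<beta> (t / m)"
    using h by (subst pos_divide_le_eq) auto
qed

section \<open>The two hypotheses\<close>

lemma sum_atMost_split_0:
  fixes f :: "nat \<Rightarrow> 'a::comm_monoid_add"
  shows "(\<Sum>j\<le>n. f j) = f 0 + (\<Sum>j=1..n. f j)"
  by (simp add: atMost_atLeast0 sum.atLeast_Suc_atMost)

context
  fixes s m \<delta> :: real and q :: nat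
  assumes s: "1 \<le> s" and m: "1 \<le> m" and \<delta>: "0 < \<delta>" "2 ^ Suc q * \<delta> \<le> 1 / 2"
begin

text \<open>The signs of an alternating binomial sum cannot all sit in one density. Writing -(-1)^j
  as (1 - (-1)^j) - 1 splits them into two non-negative weight systems, one per hypothesis.\<close>

definition null_density :: "real \<Rightarrow> real" where
  "null_density = contaminated s m (Suc q) \<delta> (\<lambda>j. real (Suc q choose j) * (1 - (- 1) ^ j))"

text \<open>The weights omit j = 0, so the mixture has mass 1 - \<delta>; the missing mass \<delta>
  is the atom at 0 that p = \<delta> supplies. The division cancels against the factor 1 - p in the
  law of an observation.\<close>

definition alt_density :: "real \<Rightarrow> real" where
  "alt_density x = contaminated s m (Suc q) \<delta> (\<lambda>j. real (Suc q choose j)) x / (1 - \<delta>)"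

lemma delta_le_half: "\<delta> \<le> 1 / 2"
proof -
  have "1 * \<delta> \<le> 2 ^ Suc q * \<delta>"
    using \<delta>(1) by (intro mult_right_mono one_le_power) auto
  then show ?thesis
    using \<delta>(2) by linarith
qed

lemma null_weight_nonneg: "0 \<le> real (Suc q choose j) * (1 - (- 1) ^ j)"
  by (cases "even j") auto

lemma alt_weight_nonneg: "0 \<le> real (Suc q choose j)"
  by simp

lemma sum_alt_weights: "(\<Sum>j=1..Suc q. real (Suc q choose j)) = 2 ^ Suc q - 1"
proof -
  have "(\<Sum>j\<le>Suc q. real (Suc q choose j)) = 2 ^ Suc q"
    unfolding of_nat_sum[symmetric] choose_row_sum by simp
  then show ?thesis
    unfolding sum_atMost_split_0 by simp
qed

lemma sum_null_weights: "(\<Sum>j=1..Suc q. real (Suc q choose j) * (1 - (- 1) ^ j)) = 2 ^ Suc q"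
proof -
  have "(\<Sum>j\<le>Suc q. real (Suc q choose j) * (1 - (- 1) ^ j)) =
      (\<Sum>j\<le>Suc q. real (Suc q choose j)) - (\<Sum>j\<le>Suc q. (- 1) ^ j * real (Suc q choose j))"
    by (simp only: right_diff_distrib sum_subtractf mult.left_neutral mult.commute)
  also have "(\<Sum>j\<le>Suc q. real (Suc q choose j)) = 2 ^ Suc q"
    unfolding of_nat_sum[symmetric] choose_row_sum by simp
  also have "(\<Sum>j\<le>Suc q. (- 1) ^ j * real (Suc q choose j)) = 0"
    by (rule choose_alternating_sum) simp
  finally show ?thesis
    unfolding sum_atMost_split_0 by simp
qed

lemma prob_density_null: "prob_density null_density"
  and null_density_bounded: "\<exists>B. \<forall>x. null_density x \<le> B"
  and null_density_ge: "heavy_density s x / 2 \<le> null_density x"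
  and norm_fourier_null_le: "cmod (fourier null_density t) \<le>
    2 * (exp (- (s\<^sup>2 * t\<^sup>2 / 2)) + (2 ^ Suc q * \<delta>) * exp (- (t\<^sup>2 / m\<^sup>2)))"
proof -
  note prems = s m less_imp_le[OF \<delta>(1)] \<delta>(2) null_weight_nonneg
  have ge: "heavy_density s x / 2 \<le> null_density x" for x
    unfolding null_density_def by (rule contaminated_ge[OF prems])
  show "prob_density null_density"
  proof (rule prob_densityI)
    show "integrable lborel null_density"
      unfolding null_density_def by (rule contaminated_integrable[OF prems])
    show "0 \<le> null_density x" for x
      using ge[of x] heavy_density_nonneg[OF s, of x] by linarith
    show "(\<integral>x. null_density x \<partial>lborel) = 1"
      unfolding null_density_def contaminated_integral[OF prems] sum_null_weights by simp
  qed
  show "\<exists>B. \<forall>x. null_density x \<le> B"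
    unfolding null_density_def by (rule contaminated_bounded[OF prems])
  show "heavy_density s x / 2 \<le> null_density x"
    by (rule ge)
  have "cmod (fourier null_density t) \<le> exp (- (s\<^sup>2 * t\<^sup>2 / 2)) + (2 ^ Suc q * \<delta>) * exp (- (t\<^sup>2 / m\<^sup>2))"
    unfolding null_density_def
    by (rule norm_fourier_contaminated_le[OF prems]) (simp only: sum_null_weights order_refl)
  \<comment> \<open>Doubled to match the form forced on the alternative by its
    normalisation.\<close>
  also have "\<dots> \<le> 2 * (exp (- (s\<^sup>2 * t\<^sup>2 / 2)) + (2 ^ Suc q * \<delta>) * exp (- (t\<^sup>2 / m\<^sup>2)))"
    using \<delta>(1) by (simp add: add_nonneg_nonneg)
  finally show "cmod (fourier null_density t) \<le>
      2 * (exp (- (s\<^sup>2 * t\<^sup>2 / 2)) + (2 ^ Suc q * \<delta>) * exp (- (t\<^sup>2 / m\<^sup>2)))" .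
qed

lemma fourier_alt: "fourier alt_density t =
    fourier (contaminated s m (Suc q) \<delta> (\<lambda>j. real (Suc q choose j))) t / (1 - \<delta>)"
proof -
  note prems = s m less_imp_le[OF \<delta>(1)] \<delta>(2) alt_weight_nonneg
  let ?c = "contaminated s m (Suc q) \<delta> (\<lambda>j. real (Suc q choose j))"
  have int: "integrable lborel ?c"
    by (rule contaminated_integrable[OF prems])
  have "fourier (\<lambda>x. 1 / (1 - \<delta>) * ?c x + 0 * ?c x) t = (1 / (1 - \<delta>)) * fourier ?c t + 0 * fourier ?c t"
    using fourier_lincomb[OF int int, of "1 / (1 - \<delta>)" 0 t]
    by simp
  then show ?thesis
    by (simp add: alt_density_def[abs_def])
qed

text \<open>\<delta> \<le> 1/2 bounds the normalising factor 1 / (1 - \<delta>) by 2, the source of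
  the 2 in the transform bound.\<close>

lemma prob_density_alt: "prob_density alt_density"
  and alt_density_bounded: "\<exists>B. \<forall>x. alt_density x \<le> B"
  and norm_fourier_alt_le: "cmod (fourier alt_density t) \<le>
    2 * (exp (- (s\<^sup>2 * t\<^sup>2 / 2)) + (2 ^ Suc q * \<delta>) * exp (- (t\<^sup>2 / m\<^sup>2)))"
proof -
  note prems = s m less_imp_le[OF \<delta>(1)] \<delta>(2) alt_weight_nonneg
  let ?c = "contaminated s m (Suc q) \<delta> (\<lambda>j. real (Suc q choose j))"
  have half: "1 / 2 \<le> 1 - \<delta>"
    using delta_le_half by simp
  show "prob_density alt_density"
  proof (rule prob_densityI)
    show "integrable lborel alt_density"
      unfolding alt_density_def using contaminated_integrable[where w = "\<lambda>j. real (Suc q choose j)", OF prems] by simp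
    have "heavy_density s x / 2 \<le> ?c x" for x
      by (rule contaminated_ge[OF prems])
    then have "0 \<le> ?c x" for x
      using heavy_density_nonneg[OF s, of x] by (meson divide_nonneg_pos order_trans zero_less_numeral)
    then show "0 \<le> alt_density x" for x
      using half by (simp add: alt_density_def)
    have "(\<integral>x. alt_density x \<partial>lborel) = (\<integral>x. ?c x \<partial>lborel) / (1 - \<delta>)"
      unfolding alt_density_def by simp
    also have "(\<integral>x. ?c x \<partial>lborel) = 1 - \<delta>"
      unfolding contaminated_integral[OF prems] sum_alt_weights by (simp add: algebra_simps)
    finally show "(\<integral>x. alt_density x \<partial>lborel) = 1"
      using half by simp
  qed
  obtain B where "\<And>x. ?c x \<le> B"
    using contaminated_bounded[where w = "\<lambda>j. real (Suc q choose j)", OF prems] by blast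
  then have "alt_density x \<le> B / (1 - \<delta>)" for x
    unfolding alt_density_def using half by (intro divide_right_mono) auto
  then show "\<exists>B. \<forall>x. alt_density x \<le> B"
    by blast
  have le: "cmod (fourier ?c t) \<le> exp (- (s\<^sup>2 * t\<^sup>2 / 2)) + (2 ^ Suc q * \<delta>) * exp (- (t\<^sup>2 / m\<^sup>2))"
    by (rule norm_fourier_contaminated_le[OF prems]) (simp only: sum_alt_weights; simp)
  have "cmod (fourier alt_density t) = cmod (fourier ?c t) / (1 - \<delta>)"
    using half by (simp add: fourier_alt norm_divide del: of_real_diff add: of_real_diff[symmetric])
  also have "\<dots> \<le> cmod (fourier ?c t) / (1 / 2)"
    using half by (intro divide_left_mono) auto
  finally show "cmod (fourier alt_density t) \<le>
      2 * (exp (- (s\<^sup>2 * t\<^sup>2 / 2)) + (2 ^ Suc q * \<delta>) * exp (- (t\<^sup>2 / m\<^sup>2)))"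
    using le by simp
qed

text \<open>The binomial weights are chosen so that the two mixtures differ, in the Fourier domain, by
  the binomial expansion of \<open>(1 - exp (- t\<^sup>2 / m\<^sup>2)) ^ Suc q\<close>, which vanishes to high order at \<open>0\<close>.\<close>

lemma fourier_null_minus_alt:
  "fourier null_density t - (\<delta> + (1 - \<delta>) * fourier alt_density t) =
    - \<delta> * complex_of_real ((1 - exp (- (t / m)\<^sup>2)) ^ Suc q)"
proof -
  note prems = s m less_imp_le[OF \<delta>(1)] \<delta>(2)
  let ?H = "complex_of_real (1 - 2 ^ Suc q * \<delta>) * fourier (heavy_density s) t"
  let ?E = "exp (- (t\<^sup>2 / m\<^sup>2))"
  let ?C = "\<lambda>j. real (Suc q choose j)"
  have null: "fourier null_density t = ?H + complex_of_real (\<delta> * (\<Sum>j=1..Suc q. (?C j * (1 - (- 1) ^ j)) * ?E ^ j))"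
    unfolding null_density_def
    using fourier_contaminated[where w = "\<lambda>j. real (Suc q choose j) * (1 - (- 1) ^ j)",
        OF prems null_weight_nonneg, of t] by (simp del: power_Suc sum.cl_ivl_Suc)
  have "1 - \<delta> \<noteq> 0"
    using delta_le_half by simp
  then have "complex_of_real (1 - \<delta>) \<noteq> 0"
    by (simp only: of_real_eq_0_iff not_False_eq_True)
  then have alt: "complex_of_real (1 - \<delta>) * fourier alt_density t = ?H + complex_of_real (\<delta> * (\<Sum>j=1..Suc q. ?C j * ?E ^ j))"
    unfolding fourier_alt
    using fourier_contaminated[where w = "\<lambda>j. real (Suc q choose j)", OF prems alt_weight_nonneg, of t] by (simp del: power_Suc sum.cl_ivl_Suc)
  have "(1 - ?E) ^ Suc q = (- ?E + 1) ^ Suc q"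
    by simp
  also have "\<dots> = (\<Sum>j\<le>Suc q. ?C j * (- ?E) ^ j)"
    by (subst binomial_ring) (simp only: power_one mult.right_neutral of_nat_id)
  also have "\<dots> = 1 + (\<Sum>j=1..Suc q. ?C j * (- ?E) ^ j)"
    unfolding sum_atMost_split_0 by simp
  finally have bin: "(1 - ?E) ^ Suc q = 1 + (\<Sum>j=1..Suc q. ?C j * (- ?E) ^ j)" .
  have "(\<Sum>j=1..Suc q. (?C j * (1 - (- 1) ^ j)) * ?E ^ j) - (\<Sum>j=1..Suc q. ?C j * ?E ^ j) =
      - (\<Sum>j=1..Suc q. ?C j * (- ?E) ^ j)"
    unfolding sum_subtractf[symmetric] sum_negf[symmetric]
    by (intro sum.cong refl) (simp add: power_minus[of ?E] algebra_simps)
  then have diff: "\<delta> * (\<Sum>j=1..Suc q. (?C j * (1 - (- 1) ^ j)) * ?E ^ j) - (\<delta> + \<delta> * (\<Sum>j=1..Suc q. ?C j * ?E ^ j)) =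
      - \<delta> * (1 - ?E) ^ Suc q"
    unfolding bin by (simp only: algebra_simps)
  have "fourier null_density t - (\<delta> + (1 - \<delta>) * fourier alt_density t) =
      complex_of_real (\<delta> * (\<Sum>j=1..Suc q. (?C j * (1 - (- 1) ^ j)) * ?E ^ j) - (\<delta> + \<delta> * (\<Sum>j=1..Suc q. ?C j * ?E ^ j)))"
    using alt unfolding null of_real_diff of_real_add by (simp only: algebra_simps)
  then show ?thesis
    unfolding diff by (simp add: power_divide)
qed

end

section \<open>The minimax lower bound\<close>

text \<open>All analysis at a fixed resolution \<open>m\<close>; the choice of \<open>m\<close> and
  \<delta> is left to the hypotheses \<open>K\<close> and \<open>chi\<close>. In \<open>c\<close>,
  the first quotient is the constant of the heavy component, one half is lost to the contamination,
  the other half and the integral to the convolution.\<close>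

lemma risk_ge_at_resolution:
  fixes \<alpha> \<beta> K d s m \<delta> A :: real and k :: "real \<Rightarrow> real" and q n :: nat
  assumes \<alpha>: "0 < \<alpha>" and \<beta>: "1 / 2 < \<beta>" "\<beta> \<le> 2 * real q" and d: "0 < d" and k: "prob_density k"
    and \<phi>: "\<And>t. cmod (char (density lborel k) t) \<le> d / (1 + \<bar>t\<bar> powr \<beta>)"
    and \<phi>': "\<And>t. char (density lborel k) differentiable (at t)"
      "\<And>t. cmod (vector_derivative (char (density lborel k)) (at t)) \<le> d / (1 + \<bar>t\<bar> powr \<beta>)"
    and s: "1 \<le> s" and m: "1 \<le> m" and \<delta>: "0 < \<delta>" "2 ^ Suc q * \<delta> \<le> 1 / 2"
    and K: "8 * gaussian_sobolev \<alpha> * (1 / s + (2 ^ Suc q * \<delta>)\<^sup>2 * m powr (2 * \<alpha> + 1)) \<le> K"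
    and n: "1 \<le> n" and T: "T \<in> estimators n" and A: "0 \<le> A"
  defines "c \<equiv> exp (- 2) / (2 * s * sqrt (2 * pi)) / 2 / 2 * (\<integral>y. k y / (1 + y\<^sup>2) \<partial>lborel)"
  assumes chi: "(\<delta> * ((2 * real q + 3) * d * 2 powr \<beta> * m powr (- \<beta>)))\<^sup>2 * m * envelope_mass \<beta> / pi / c \<le> A / real n"
  shows "ennreal (\<delta>\<^sup>2 / (4 * exp A)) \<le> (SUP (f, p)\<in>sobolev_class \<alpha> K \<times> {0..<1}. sq_risk k n T p f)"
proof -
  let ?\<phi> = "char (density lborel k)"
  define f0 where "f0 = null_density s m \<delta> q"
  define f1 where "f1 = alt_density s m \<delta> q"
  note prems = s m \<delta>
  have f0: "prob_density f0" and f1: "prob_density f1"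
    unfolding f0_def f1_def by (rule prob_density_null[OF prems] prob_density_alt[OF prems])+
  obtain B0 B1 where B0: "\<And>x. f0 x \<le> B0" and B1: "\<And>x. f1 x \<le> B1"
    using null_density_bounded[OF prems] alt_density_bounded[OF prems] unfolding f0_def f1_def by blast
  have "\<delta> \<le> 1 / 2"
    by (rule delta_le_half[OF prems])
  then have \<delta>1: "0 \<le> \<delta>" "\<delta> \<le> 1" "\<delta> < 1"
    using \<delta> by auto
  have f0_class: "f0 \<in> sobolev_class \<alpha> K" and f1_class: "f1 \<in> sobolev_class \<alpha> K"
    using norm_fourier_null_le[OF prems] norm_fourier_alt_le[OF prems] \<delta>1 unfolding f0_def f1_def
    by (intro sobolev_classI[OF \<alpha> _ s m _ _ K] prob_density_null[OF prems] prob_density_alt[OF prems]; simp)+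
  define q0 where "q0 = obs_density k 0 f0"
  define q1 where "q1 = obs_density k \<delta> f1"
  have law0: "obs_law k 0 f0 = density lborel q0" and q0: "prob_density q0"
    unfolding q0_def by (rule obs_law_eq_density[OF k f0 _ _ B0]; simp)+
  have law1: "obs_law k \<delta> f1 = density lborel q1" and q1: "prob_density q1"
    unfolding q1_def by (rule obs_law_eq_density[OF k f1 \<delta>1(1,2) B1])+
  note int0 = prob_density_integrable(1)[OF q0] and int1 = prob_density_integrable(1)[OF q1]
  define D where "D x = q0 x - q1 x" for x
  have intD: "integrable lborel D"
    unfolding D_def using int0 int1 by simp
  define \<psi> where "\<psi> t = complex_of_real ((1 - exp (- (t / m)\<^sup>2)) ^ Suc q) * ?\<phi> t" for t
  \<comment> \<open>Both observation densities carry the noise transform as a factor, so only the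
    difference of the signal parts survives.\<close>
  have fourier_D: "fourier D t = - \<delta> * \<psi> t" for t
  proof -
    have "fourier D t = fourier q0 t - fourier q1 t"
      using fourier_lincomb[OF int0 int1, of 1 "-1" t] by (simp add: D_def[abs_def])
    also have "fourier q0 t = fourier f0 t * ?\<phi> t"
      using char_obs_law[OF k f0, of 0 t] char_density_eq_fourier[of q0 t] q0
      unfolding law0 by (simp add: prob_density_def)
    also have "fourier q1 t = (\<delta> + (1 - \<delta>) * fourier f1 t) * ?\<phi> t"
      using char_obs_law[OF k f1 \<delta>1(1,2), of t] char_density_eq_fourier[of q1 t] q1
      unfolding law1 by (simp add: prob_density_def)
    also have "fourier f0 t * ?\<phi> t - (\<delta> + (1 - \<delta>) * fourier f1 t) * ?\<phi> t =
        (fourier f0 t - (\<delta> + (1 - \<delta>) * fourier f1 t)) * ?\<phi> t"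
      by (simp only: left_diff_distrib)
    finally show ?thesis
      unfolding f0_def f1_def fourier_null_minus_alt[OF prems] \<psi>_def by simp
  qed
  define a where "a = (2 * real q + 3) * d * 2 powr \<beta> * m powr (- \<beta>)"
  have deriv: "(?\<phi> has_vector_derivative vector_derivative ?\<phi> (at t)) (at t)" for t
    using \<phi>'(1) by (simp add: vector_derivative_works)
  have \<beta>0: "0 < \<beta>" and m0: "0 < m"
    using \<beta> m by auto
  have \<psi>_le: "cmod (\<psi> t) \<le> a * envelope \<beta> (t / m)" for t
    unfolding \<psi>_def a_def by (rule high_pass_bounds(1)[OF \<beta>0 \<beta>(2) m d \<phi> deriv \<phi>'(2)])
  have \<psi>_diff_le: "cmod (\<psi> (t + h) - \<psi> (t - h)) / (2 * h) \<le> a * envelope \<beta> (t / m)" if "0 < h" "h \<le> 1" for t h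
    unfolding \<psi>_def a_def by (rule high_pass_bounds(2)[OF \<beta>0 \<beta>(2) m d \<phi> deriv \<phi>'(2) that])
  \<comment> \<open>Squared amplitude times band width: the L^2 bound common to the transform and
    its difference quotients.\<close>
  define M where "M = (\<delta> * a)\<^sup>2 * m * envelope_mass \<beta>"
  have M: "0 \<le> M"
    using m envelope_mass_nonneg[of \<beta>] by (simp add: M_def)
  have "(\<integral>\<^sup>+x. ennreal ((1 + x\<^sup>2) * (D x)\<^sup>2) \<partial>lborel) \<le> ennreal (M / pi)"
  proof (rule nn_integral_weighted_square_le_fourier[OF intD M])
    show "(\<integral>\<^sup>+t. ennreal ((cmod (fourier D t))\<^sup>2) \<partial>lborel) \<le> ennreal M"
      unfolding M_def
    proof (rule nn_integral_envelope_le[OF \<beta>(1) m0])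
      show "cmod (fourier D t) \<le> \<delta> * a * envelope \<beta> (t / m)" for t
        using mult_left_mono[OF \<psi>_le[of t] \<delta>1(1)] \<delta>1 by (simp add: fourier_D norm_mult)
    qed simp
    fix h :: real assume h: "0 < h" "h \<le> 1"
    show "(\<integral>\<^sup>+t. ennreal ((cmod (fourier D (t + h) - fourier D (t - h)) / (2 * h))\<^sup>2) \<partial>lborel) \<le> ennreal M"
      unfolding M_def
    proof (rule nn_integral_envelope_le[OF \<beta>(1) m0])
      fix t
      have "fourier D (t + h) - fourier D (t - h) = - \<delta> * (\<psi> (t + h) - \<psi> (t - h))"
        by (simp add: fourier_D right_diff_distrib)
      then show "cmod (fourier D (t + h) - fourier D (t - h)) / (2 * h) \<le> \<delta> * a * envelope \<beta> (t / m)"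
        using mult_left_mono[OF \<psi>_diff_le[OF h, of t] \<delta>1(1)] \<delta>1 by (simp add: norm_mult)
    qed (use h in simp)
  qed
  then have WD: "(\<integral>\<^sup>+x. ennreal ((1 + x\<^sup>2) * (q0 x - q1 x)\<^sup>2) \<partial>lborel) \<le> ennreal (M / pi)"
    by (simp add: D_def)
  have c: "0 < c"
    unfolding c_def using s integral_density_weight_pos[OF k] by (intro mult_pos_pos) auto
  have low: "c / (1 + x\<^sup>2) \<le> q0 x" for x
    unfolding c_def q0_def
  proof (rule obs_density_ge[OF k f0 B0])
    fix x
    have "exp (- 2) / (2 * s * sqrt (2 * pi)) / 2 / (1 + x\<^sup>2) = exp (- 2) / (2 * s * sqrt (2 * pi)) / (1 + x\<^sup>2) / 2"
      by simp
    also have "\<dots> \<le> heavy_density s x / 2"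
      by (intro divide_right_mono heavy_density_ge[OF s]) simp
    also have "\<dots> \<le> f0 x"
      unfolding f0_def by (rule null_density_ge[OF prems])
    finally show "exp (- 2) / (2 * s * sqrt (2 * pi)) / 2 / (1 + x\<^sup>2) \<le> f0 x" .
  qed (use s in simp)
  have W0: "0 \<le> M / pi"
    using M by simp
  note ratio = density_ratio_second_moment[OF q0 q1 c W0 low WD]
  have L2: "(\<integral>\<^sup>+x. (ennreal (q1 x / q0 x))\<^sup>2 \<partial>density lborel q0) \<le> ennreal (1 + A / real n)"
    using chi unfolding M_def a_def by (intro order_trans[OF ratio(2)] ennreal_leI) (simp add: M_def a_def)
  have [measurable]: "q0 \<in> borel_measurable borel" "q1 \<in> borel_measurable borel"
    using q0 q1 by (auto simp: prob_density_def)
  show ?thesis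
  proof (rule two_point_risk_le[where P = "density lborel q0" and L = "\<lambda>x. ennreal (q1 x / q0 x)"])
    show "prob_space (density lborel q0)"
      by (rule prob_space_density_lborel[OF q0])
    show "prob_space (density (density lborel q0) (\<lambda>x. ennreal (q1 x / q0 x)))"
      unfolding ratio(1) by (rule prob_space_density_lborel[OF q1])
    have "sq_risk k n T 0 f0 \<le> (SUP (f, p)\<in>sobolev_class \<alpha> K \<times> {0..<1}. sq_risk k n T p f)"
      using f0_class by (intro SUP_upper2[of "(f0, 0)"]) auto
    then show "(\<integral>\<^sup>+x. ennreal ((T x - 0)\<^sup>2) \<partial>(\<Pi>\<^sub>M i\<in>{..<n}. density lborel q0))
        \<le> (SUP (f, p)\<in>sobolev_class \<alpha> K \<times> {0..<1}. sq_risk k n T p f)"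
      unfolding sq_risk_def[of k n T 0 f0] law0 .
    have "sq_risk k n T \<delta> f1 \<le> (SUP (f, p)\<in>sobolev_class \<alpha> K \<times> {0..<1}. sq_risk k n T p f)"
      using f1_class \<delta>1 by (intro SUP_upper2[of "(f1, \<delta>)"]) auto
    then show "(\<integral>\<^sup>+x. ennreal ((T x - \<delta>)\<^sup>2) \<partial>(\<Pi>\<^sub>M i\<in>{..<n}. density (density lborel q0) (\<lambda>x. ennreal (q1 x / q0 x))))
        \<le> (SUP (f, p)\<in>sobolev_class \<alpha> K \<times> {0..<1}. sq_risk k n T p f)"
      unfolding sq_risk_def[of k n T \<delta> f1] law1 ratio(1) .
  qed (use n A T \<delta>1 L2 in auto)
qed

theorem theorem5:
  fixes \<alpha> K\<^sub>\<Sigma> d\<^sub>1 \<beta> :: real and k :: "real \<Rightarrow> real"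
  assumes "\<alpha> > 0" and "K\<^sub>\<Sigma> > 0" and "d\<^sub>1 > 0" and "\<beta> > 1 / 2"
    and "prob_density k"
    and "\<And>t. cmod (char (density lborel k) t) \<le> d\<^sub>1 / (1 + \<bar>t\<bar> powr \<beta>)"
    and "\<And>t. char (density lborel k) differentiable (at t)"
    and "\<And>t. cmod (vector_derivative (char (density lborel k)) (at t))
               \<le> d\<^sub>1 / (1 + \<bar>t\<bar> powr \<beta>)"
  shows "\<exists>c>0. \<forall>n\<ge>1.
           (INF T\<in>estimators n. SUP (f, p)\<in>sobolev_class \<alpha> K\<^sub>\<Sigma> \<times> {0..<1}. sq_risk k n T p f)
           \<ge> ennreal (c * real n powr (- (2 * \<alpha> + 1) / (2 * \<alpha> + 2 * \<beta>)))"
proof -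
  \<comment> \<open>The least natural number with \<beta> \<le> 2 q.\<close>
  define q where "q = nat \<lceil>\<beta> / 2\<rceil>"
  have q: "\<beta> \<le> 2 * real q"
    unfolding q_def by linarith
  let ?R = "2 ^ Suc q :: real"
  define G where "G = gaussian_sobolev \<alpha>"
  have G: "0 \<le> G"
    by (simp add: G_def gaussian_sobolev_nonneg)
  \<comment> \<open>The Sobolev budget is halved: this \<open>s\<close> leaves at most
    \<open>K\<^sub>\<Sigma> / 2\<close> to the heavy component.\<close>
  define s where "s = max 1 (16 * G / K\<^sub>\<Sigma>)"
  have s: "1 \<le> s"
    by (simp add: s_def)
  \<comment> \<open>The first bound keeps half of the heavy component, the second gives the narrow
    Gaussians the other half of the budget; G + 1 guards against division by 0.\<close>
  define \<epsilon> where "\<epsilon> = min (1 / (2 * ?R)) (sqrt (K\<^sub>\<Sigma> / (16 * (G + 1))) / ?R)"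
  have R: "0 < ?R"
    by simp
  have \<epsilon>: "0 < \<epsilon>"
    using assms(2) G by (simp add: \<epsilon>_def)
  have \<epsilon>_half: "?R * \<epsilon> \<le> 1 / 2"
  proof -
    have "?R * \<epsilon> \<le> ?R * (1 / (2 * ?R))"
      by (intro mult_left_mono) (auto simp: \<epsilon>_def)
    then show ?thesis by simp
  qed
  have \<epsilon>_K: "8 * G * (?R * \<epsilon>)\<^sup>2 \<le> K\<^sub>\<Sigma> / 2"
  proof -
    have "?R * \<epsilon> \<le> ?R * (sqrt (K\<^sub>\<Sigma> / (16 * (G + 1))) / ?R)"
      by (intro mult_left_mono) (auto simp: \<epsilon>_def)
    then have "?R * \<epsilon> \<le> sqrt (K\<^sub>\<Sigma> / (16 * (G + 1)))"
      by simp
    then have "(?R * \<epsilon>)\<^sup>2 \<le> (sqrt (K\<^sub>\<Sigma> / (16 * (G + 1))))\<^sup>2"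
      using \<epsilon> by (intro power_mono) auto
    also have "\<dots> = K\<^sub>\<Sigma> / (16 * (G + 1))"
      using assms(2) G by simp
    finally have "8 * G * (?R * \<epsilon>)\<^sup>2 \<le> 8 * (G + 1) * (K\<^sub>\<Sigma> / (16 * (G + 1)))"
      using G by (intro mult_mono) auto
    also have "\<dots> = K\<^sub>\<Sigma> / 2"
      using G by (simp add: field_simps)
    finally show ?thesis .
  qed
  have s_K: "8 * G * (1 / s) \<le> K\<^sub>\<Sigma> / 2"
  proof -
    have "16 * G / K\<^sub>\<Sigma> \<le> s"
      by (simp add: s_def)
    then show ?thesis
      using assms(2) s by (simp add: field_simps)
  qed
  define c where "c = exp (- 2) / (2 * s * sqrt (2 * pi)) / 2 / 2 * (\<integral>y. k y / (1 + y\<^sup>2) \<partial>lborel)"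
  have c: "0 < c"
    unfolding c_def using s integral_density_weight_pos[OF assms(5)] by (intro mult_pos_pos) auto
  define C where "C = (2 * real q + 3) * d\<^sub>1 * 2 powr \<beta>"
  define A where "A = (\<epsilon> * C)\<^sup>2 * envelope_mass \<beta> / pi / c"
  have A: "0 \<le> A"
    unfolding A_def using c envelope_mass_nonneg[of \<beta>] by simp
  show ?thesis
  proof (intro exI[of _ "\<epsilon>\<^sup>2 / (4 * exp A)"] conjI allI impI)
    show "0 < \<epsilon>\<^sup>2 / (4 * exp A)"
      using \<epsilon> by simp
    fix n :: nat assume n: "1 \<le> n"
    \<comment> \<open>Chosen so that m^(2\<alpha>+2\<beta>) = n. For n \<ge> 1 also m \<ge> 1, so
      the same constants serve every \<open>n\<close>.\<close>
    define m where "m = real n powr (1 / (2 * \<alpha> + 2 * \<beta>))"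
    \<comment> \<open>Up to a constant, the largest amplitude compatible with the Sobolev bound at
      resolution \<open>m\<close>.\<close>
    define \<delta> where "\<delta> = \<epsilon> * m powr (- (\<alpha> + 1 / 2))"
    have ab: "0 < 2 * \<alpha> + 2 * \<beta>"
      using assms(1,4) by simp
    have m: "1 \<le> m"
      unfolding m_def using n ab by (intro ge_one_powr_ge_zero) auto
    have \<delta>0: "0 < \<delta>"
      using \<epsilon> m by (simp add: \<delta>_def)
    have "m powr (- (\<alpha> + 1 / 2)) \<le> 1"
      using m assms(1) powr_mono[of "- (\<alpha> + 1 / 2)" 0 m] by simp
    then have "\<delta> \<le> \<epsilon>"
      using \<epsilon> unfolding \<delta>_def by (intro mult_left_le) auto
    then have "?R * \<delta> \<le> ?R * \<epsilon>"
      by (intro mult_left_mono) auto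
    then have \<delta>1: "?R * \<delta> \<le> 1 / 2"
      using \<epsilon>_half by linarith
    have \<delta>_sq: "\<delta>\<^sup>2 = \<epsilon>\<^sup>2 * m powr (- (2 * \<alpha> + 1))"
      unfolding \<delta>_def power_mult_distrib
      by (simp add: power2_eq_square flip: powr_add)
    have K: "8 * gaussian_sobolev \<alpha> * (1 / s + (?R * \<delta>)\<^sup>2 * m powr (2 * \<alpha> + 1)) \<le> K\<^sub>\<Sigma>"
    proof -
      have "m powr (- (2 * \<alpha> + 1)) * m powr (2 * \<alpha> + 1) = 1"
        using m by (simp flip: powr_add)
      then have "(?R * \<delta>)\<^sup>2 * m powr (2 * \<alpha> + 1) = (?R * \<epsilon>)\<^sup>2"
        unfolding power_mult_distrib[of ?R] \<delta>_sq by (simp add: mult.assoc)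
      then show ?thesis
        using \<epsilon>_K s_K unfolding G_def[symmetric] by (simp only: distrib_left)
    qed
    have chi: "(\<delta> * ((2 * real q + 3) * d\<^sub>1 * 2 powr \<beta> * m powr (- \<beta>)))\<^sup>2 * m * envelope_mass \<beta> / pi /
        (exp (- 2) / (2 * s * sqrt (2 * pi)) / 2 / 2 * (\<integral>y. k y / (1 + y\<^sup>2) \<partial>lborel)) \<le> A / real n"
    proof -
      have "m powr (2 * \<alpha> + 2 * \<beta>) = real n"
        using n ab by (simp add: m_def powr_powr)
      \<comment> \<open>The balance of the rate: squared amplitude, squared noise decay and band
        width multiply to m^(-(2\<alpha>+2\<beta>)), that is 1 / n.\<close>
      moreover have "m powr (- (2 * \<alpha> + 1)) * (m powr (- \<beta>))\<^sup>2 * m = m powr (- (2 * \<alpha> + 2 * \<beta>))"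
      proof -
        have "m powr (- (2 * \<alpha> + 1)) * (m powr (- \<beta>))\<^sup>2 * m =
            m powr (- (2 * \<alpha> + 1)) * (m powr (- \<beta>) * m powr (- \<beta>)) * m powr 1"
          using m by (simp add: power2_eq_square)
        also have "\<dots> = m powr (- (2 * \<alpha> + 1) + (- \<beta> + - \<beta>) + 1)"
          by (simp only: powr_add)
        finally show ?thesis by simp
      qed
      ultimately have eq: "m powr (- (2 * \<alpha> + 1)) * (m powr (- \<beta>))\<^sup>2 * m = 1 / real n"
        by (simp only: powr_minus_divide)
      have "(\<delta> * (C * m powr (- \<beta>)))\<^sup>2 * m = (\<epsilon> * C)\<^sup>2 * (m powr (- (2 * \<alpha> + 1)) * (m powr (- \<beta>))\<^sup>2 * m)"
        unfolding power_mult_distrib \<delta>_sq by (simp only: mult_ac)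
      then show ?thesis
        unfolding c_def[symmetric] C_def[symmetric] A_def eq by (simp add: mult_ac)
    qed
    have \<delta>_rate: "\<delta>\<^sup>2 / (4 * exp A) = \<epsilon>\<^sup>2 / (4 * exp A) * real n powr (- (2 * \<alpha> + 1) / (2 * \<alpha> + 2 * \<beta>))"
      unfolding \<delta>_sq m_def powr_powr by simp
    show "ennreal (\<epsilon>\<^sup>2 / (4 * exp A) * real n powr (- (2 * \<alpha> + 1) / (2 * \<alpha> + 2 * \<beta>)))
        \<le> (INF T\<in>estimators n. SUP (f, p)\<in>sobolev_class \<alpha> K\<^sub>\<Sigma> \<times> {0..<1}. sq_risk k n T p f)"
      unfolding \<delta>_rate[symmetric]
      by (intro INF_greatest risk_ge_at_resolution[OF assms(1,4) q assms(3,5-8) s m \<delta>0 \<delta>1 K n _ A chi])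
  qed
qed

end
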